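(* Let $G$ and $H$ be profinite groups with $G \equiv H$. Suppose that $G$ is small and that for each finite group $A$ there exists a group word $w$ with $w(A) = \{1\}$ such that the verbal subgroup $w(G)$ is open in $G$. Then $G \cong H$.
   Context: A profinite group is called small if for each positive integer $n$ it has only finitely many open subgroups of index $n$. $G \equiv H$ (elementary equivalence) means that $G$ and $H$, regarded as abstract groups, satisfy the same first-order sentences in the language of groups. $G \cong H$ means isomorphic as profinite groups (i.e. via a group isomorphism that is a homeomorphism). A group word $w(\mathbf{x})$ in variables $\mathbf{x} = (x_1, \dots, x_n)$ is an element of the free group on $x_1, \dots, x_n$. For a group $G$, the verbal subgroup $w(G)$ is the (abstract) subgroup of $G$ generated by all elements $w(\mathbf{g})$ with $\mathbf{g} \in G^n$. *)

theory Defs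
  imports "HOL-Analysis.Analysis" "HOL-Algebra.Generated_Groups"
begin

section \<open>Profinite groups\<close>

locale profinite_group = group G
  for G :: "('a, 'x) monoid_scheme" (structure) and T :: "'a topology" +
  assumes topspace_eq: "topspace T = carrier G"
    and continuous_mult: "continuous_map (prod_topology T T) T (\<lambda>(x, y). x \<otimes> y)"
    and continuous_inv: "continuous_map T T (\<lambda>x. inv x)"
    and compact: "compact_space T"
    and Hausdorff: "Hausdorff_space T"
    and totally_disconnected: "\<And>C. connectedin T C \<Longrightarrow> \<exists>x. C \<subseteq> {x}"

definition small_group :: "('a, 'x) monoid_scheme \<Rightarrow> 'a topology \<Rightarrow> bool" where
  "small_group G T \<longleftrightarrow>
     (\<forall>n::nat. 0 < n \<longrightarrow>
        finite {U. subgroup U G \<and> openin T U \<and>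
                   finite (rcosets\<^bsub>G\<^esub> U) \<and> card (rcosets\<^bsub>G\<^esub> U) = n})"

definition profinite_iso ::
    "('a, 'x) monoid_scheme \<Rightarrow> 'a topology \<Rightarrow> ('b, 'y) monoid_scheme \<Rightarrow> 'b topology \<Rightarrow> bool" where
  "profinite_iso G S H T \<longleftrightarrow> (\<exists>f. f \<in> iso G H \<and> homeomorphic_map S T f)"


section \<open>First-order logic of groups\<close>

datatype gterm = Var nat | One | Mult gterm gterm | Inv gterm

datatype gformula =
    Eq gterm gterm
  | Neg gformula
  | Conj gformula gformula
  | All nat gformula

primrec term_vars :: "gterm \<Rightarrow> nat set" where
  "term_vars (Var i) = {i}"
| "term_vars One = {}"
| "term_vars (Mult s t) = term_vars s \<union> term_vars t"
| "term_vars (Inv t) = term_vars t"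

primrec free_vars :: "gformula \<Rightarrow> nat set" where
  "free_vars (Eq s t) = term_vars s \<union> term_vars t"
| "free_vars (Neg p) = free_vars p"
| "free_vars (Conj p q) = free_vars p \<union> free_vars q"
| "free_vars (All i p) = free_vars p - {i}"

definition sentence :: "gformula \<Rightarrow> bool" where
  "sentence p \<longleftrightarrow> free_vars p = {}"

primrec term_val :: "('a, 'x) monoid_scheme \<Rightarrow> (nat \<Rightarrow> 'a) \<Rightarrow> gterm \<Rightarrow> 'a" where
  "term_val G e (Var i) = e i"
| "term_val G e One = \<one>\<^bsub>G\<^esub>"
| "term_val G e (Mult s t) = term_val G e s \<otimes>\<^bsub>G\<^esub> term_val G e t"
| "term_val G e (Inv t) = inv\<^bsub>G\<^esub> (term_val G e t)"

primrec sat :: "('a, 'x) monoid_scheme \<Rightarrow> (nat \<Rightarrow> 'a) \<Rightarrow> gformula \<Rightarrow> bool" where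
  "sat G e (Eq s t) \<longleftrightarrow> term_val G e s = term_val G e t"
| "sat G e (Neg p) \<longleftrightarrow> \<not> sat G e p"
| "sat G e (Conj p q) \<longleftrightarrow> sat G e p \<and> sat G e q"
| "sat G e (All i p) \<longleftrightarrow> (\<forall>a\<in>carrier G. sat G (e(i := a)) p)"

definition models :: "('a, 'x) monoid_scheme \<Rightarrow> gformula \<Rightarrow> bool" where
  "models G p \<longleftrightarrow> (\<forall>e. range e \<subseteq> carrier G \<longrightarrow> sat G e p)"

definition elementarily_equivalent ::
    "('a, 'x) monoid_scheme \<Rightarrow> ('b, 'y) monoid_scheme \<Rightarrow> bool" where
  "elementarily_equivalent G H \<longleftrightarrow> (\<forall>p. sentence p \<longrightarrow> (models G p \<longleftrightarrow> models H p))"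


section \<open>Group words and verbal subgroups\<close>

text \<open>The letter \<open>(i, True)\<close> stands for the \<open>i\<close>-th variable and \<open>(i, False)\<close> for its inverse;
  the variables in \<open>group_words n\<close> are indexed by \<open>0, \<dots>, n - 1\<close>.
  Elements of the free group are represented by their unique reduced words.
  The condition \<open>verbal_subgroup A n w = {\<one>}\<close> is invariant under isomorphism, so it is enough to impose
  it on finite groups \<open>A\<close> whose carrier is a set of natural numbers.\<close>

type_synonym gword = "(nat \<times> bool) list"

definition group_words :: "nat \<Rightarrow> gword set" where
  "group_words n =
     {w. fst ` set w \<subseteq> {..<n} \<and>
         successively (\<lambda>(i, b) (j, c). \<not> (i = j \<and> b \<noteq> c)) w}"

primrec word_val :: "('a, 'x) monoid_scheme \<Rightarrow> (nat \<Rightarrow> 'a) \<Rightarrow> gword \<Rightarrow> 'a" where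
  "word_val G g [] = \<one>\<^bsub>G\<^esub>"
| "word_val G g (l # w) =
     (if snd l then g (fst l) else inv\<^bsub>G\<^esub> (g (fst l))) \<otimes>\<^bsub>G\<^esub> word_val G g w"

definition verbal_subgroup :: "('a, 'x) monoid_scheme \<Rightarrow> nat \<Rightarrow> gword \<Rightarrow> 'a set" where
  "verbal_subgroup G n w = generate G {word_val G g w | g. g \<in> {..<n} \<rightarrow> carrier G}"

end

theory Submission
  imports Defs "HOL-Algebra.Weak_Morphisms"
begin

text \<open>
  The verbal subgroups \<open>w(G)\<close> that are open in \<open>G\<close> form a base of neighbourhoods of \<open>\<one>\<close>: the open normal
  subgroups form one (\<open>open_normal_subgroup_below\<close>), and each of them, say \<open>N\<close>, contains some open \<open>w(G)\<close>
  by the hypothesis for \<open>A = G/N\<close>. So the topology of \<open>G\<close> can be read off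
  from verbal subgroups, and these are visible to first-order logic for the following reason. If \<open>w(G)\<close> is
  open, then by Baire's theorem every element of \<open>w(G)\<close> is a product of at most \<open>M\<close> values of \<open>w\<close> and
  their inverses, for some fixed \<open>M\<close> (\<open>open_verbal_subgroup_eq_ball\<close>). Thus \<open>w(G)\<close> is definable, and so
  are the facts that \<open>M\<close> is a width and that \<open>w(G)\<close> has finite index. They pass to \<open>H\<close>, where \<open>w(H)\<close> becomes
  a compact subgroup of finite index and hence open (\<open>verbal_subgroup_transfer\<close>). The same hypothesis,
  applied to the finite quotients of \<open>H\<close>, shows that for the words with \<open>w(G)\<close> open the subgroups \<open>w(H)\<close>
  form a base of neighbourhoods in \<open>H\<close>.

  The isomorphism is found by a compactness argument that treats the elements of \<open>G\<close> as parameters.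
  Any finite set of first-order conditions that hold for elements of \<open>G\<close> can be realized in \<open>H\<close>. If the
  conditions are closed in the compact space of all maps from \<open>G\<close> to \<open>H\<close>, then infinitely many of them can
  be realized by one map \<open>f\<close> (\<open>compact_realization\<close>). Suitable conditions make \<open>f\<close> a homomorphism such
  that, whenever \<open>w(G)\<close> is open, the preimage of \<open>w(H)\<close> is \<open>w(G)\<close> and the image of \<open>f\<close> meets every coset of
  \<open>w(H)\<close> (\<open>compatible_hom_exists\<close>). As these subgroups form bases of neighbourhoods, \<open>f\<close> is continuous,
  injective and has dense image. By compactness it is a topological isomorphism.
\<close>

section \<open>First-order formulas and elementary equivalence\<close>

lemma finite_term_vars: "finite (term_vars t)"
  by (induction t) auto

lemma finite_free_vars: "finite (free_vars p)"
  by (induction p) (auto simp: finite_term_vars)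

lemma term_val_cong: "(\<And>i. i \<in> term_vars t \<Longrightarrow> e i = e' i) \<Longrightarrow> term_val G e t = term_val G e' t"
  by (induction t) auto

lemma sat_cong: "(\<And>i. i \<in> free_vars p \<Longrightarrow> e i = e' i) \<Longrightarrow> sat G e p = sat G e' p"
proof (induction p arbitrary: e e')
  case (Eq s t)
  have "term_val G e s = term_val G e' s" "term_val G e t = term_val G e' t"
    using Eq by (auto intro: term_val_cong)
  then show ?case by simp
next
  case (Conj p q)
  have "sat G e p = sat G e' p" by (rule Conj.IH) (use Conj.prems in auto)
  moreover have "sat G e q = sat G e' q" by (rule Conj.IH) (use Conj.prems in auto)
  ultimately show ?case by simp
next
  case (All i p)
  have "sat G (e(i := a)) p = sat G (e'(i := a)) p" for a
    by (rule All.IH) (use All.prems in auto)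
  then show ?case by simp
next
  case (Neg p)
  have "sat G e p = sat G e' p" by (rule Neg.IH) (use Neg.prems in auto)
  then show ?case by simp
qed

primrec rename_term :: "(nat \<Rightarrow> nat) \<Rightarrow> gterm \<Rightarrow> gterm" where
  "rename_term \<rho> (Var i) = Var (\<rho> i)"
| "rename_term \<rho> One = One"
| "rename_term \<rho> (Mult s t) = Mult (rename_term \<rho> s) (rename_term \<rho> t)"
| "rename_term \<rho> (Inv t) = Inv (rename_term \<rho> t)"

text \<open>The bound variable is replaced by one outside the image of the remaining free variables, so
  that no variable is captured, whatever \<open>\<rho>\<close> is.\<close>

primrec rename :: "(nat \<Rightarrow> nat) \<Rightarrow> gformula \<Rightarrow> gformula" where
  "rename \<rho> (Eq s t) = Eq (rename_term \<rho> s) (rename_term \<rho> t)"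
| "rename \<rho> (Neg p) = Neg (rename \<rho> p)"
| "rename \<rho> (Conj p q) = Conj (rename \<rho> p) (rename \<rho> q)"
| "rename \<rho> (All i p) =
     (let k = (SOME k. k \<notin> \<rho> ` (free_vars p - {i})) in All k (rename (\<rho>(i := k)) p))"

lemma term_val_rename: "term_val G e (rename_term \<rho> t) = term_val G (e \<circ> \<rho>) t"
  by (induction t) auto

lemma sat_rename: "sat G e (rename \<rho> p) = sat G (e \<circ> \<rho>) p"
proof (induction p arbitrary: e \<rho>)
  case (All i p)
  define k where "k = (SOME k. k \<notin> \<rho> ` (free_vars p - {i}))"
  have "\<exists>k. k \<notin> \<rho> ` (free_vars p - {i})"
    by (intro ex_new_if_finite infinite_UNIV_nat finite_imageI finite_Diff finite_free_vars)
  then have k: "k \<notin> \<rho> ` (free_vars p - {i})"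
    unfolding k_def by (rule someI_ex)
  have "sat G (e(k := a)) (rename (\<rho>(i := k)) p) = sat G ((e \<circ> \<rho>)(i := a)) p" for a
    unfolding All.IH by (rule sat_cong) (use k in auto)
  then show ?case by (simp add: k_def[symmetric] comp_def)
next
  case (Eq s t)
  then show ?case by (simp only: rename.simps sat.simps term_val_rename)
qed (simp_all only: rename.simps sat.simps)

definition Exists :: "nat \<Rightarrow> gformula \<Rightarrow> gformula" where
  "Exists i p = Neg (All i (Neg p))"

definition Disj :: "gformula \<Rightarrow> gformula \<Rightarrow> gformula" where
  "Disj p q = Neg (Conj (Neg p) (Neg q))"

primrec Exists_list :: "nat list \<Rightarrow> gformula \<Rightarrow> gformula" where
  "Exists_list [] p = p"
| "Exists_list (i # is) p = Exists i (Exists_list is p)"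

definition Conjs :: "gformula list \<Rightarrow> gformula" where
  "Conjs ps = foldr Conj ps (Eq One One)"

definition Disjs :: "gformula list \<Rightarrow> gformula" where
  "Disjs ps = Neg (Conjs (map Neg ps))"

lemma sat_Exists [simp]: "sat G e (Exists i p) \<longleftrightarrow> (\<exists>a\<in>carrier G. sat G (e(i := a)) p)"
  by (simp add: Exists_def)

lemma sat_Disj [simp]: "sat G e (Disj p q) \<longleftrightarrow> sat G e p \<or> sat G e q"
  by (simp add: Disj_def)

lemma sat_Conjs [simp]: "sat G e (Conjs ps) \<longleftrightarrow> (\<forall>p\<in>set ps. sat G e p)"
  by (induction ps) (auto simp: Conjs_def)

lemma sat_Disjs [simp]: "sat G e (Disjs ps) \<longleftrightarrow> (\<exists>p\<in>set ps. sat G e p)"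
  by (simp add: Disjs_def)

lemma sat_Exists_list:
  assumes "range e \<subseteq> carrier G"
  shows "sat G e (Exists_list is p) \<longleftrightarrow>
           (\<exists>e'. range e' \<subseteq> carrier G \<and> (\<forall>j. j \<notin> set is \<longrightarrow> e' j = e j) \<and> sat G e' p)"
  using assms
proof (induction "is" arbitrary: e)
  case Nil
  have "(\<forall>j. e' j = e j) \<longleftrightarrow> e' = e" for e' by auto
  then show ?case using Nil by auto
next
  case (Cons i "is")
  have "sat G (e(i := a)) (Exists_list is p) \<longleftrightarrow>
      (\<exists>e'. range e' \<subseteq> carrier G \<and> (\<forall>j. j \<notin> set is \<longrightarrow> e' j = (e(i := a)) j) \<and> sat G e' p)"
    if "a \<in> carrier G" for a
    by (rule Cons.IH) (use Cons.prems that in auto)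
  moreover have "sat G e (Exists_list (i # is) p) \<longleftrightarrow> (\<exists>a\<in>carrier G. sat G (e(i := a)) (Exists_list is p))"
    by simp
  ultimately have step: "sat G e (Exists_list (i # is) p) \<longleftrightarrow> (\<exists>a\<in>carrier G. \<exists>e'. range e' \<subseteq> carrier G \<and>
      (\<forall>j. j \<notin> set is \<longrightarrow> e' j = (e(i := a)) j) \<and> sat G e' p)"
    by blast
  show ?case (is "_ \<longleftrightarrow> ?R")
  proof
    assume "sat G e (Exists_list (i # is) p)"
    then obtain a e' where e': "range e' \<subseteq> carrier G" "sat G e' p"
      "\<forall>j. j \<notin> set is \<longrightarrow> e' j = (e(i := a)) j"
      unfolding step by blast
    then have "\<forall>j. j \<notin> set (i # is) \<longrightarrow> e' j = e j" by simp
    with e' show ?R by blast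
  next
    assume ?R
    then obtain e' where e': "range e' \<subseteq> carrier G" "\<forall>j. j \<notin> set (i # is) \<longrightarrow> e' j = e j" "sat G e' p"
      by blast
    then have "e' i \<in> carrier G" by auto
    with e' show "sat G e (Exists_list (i # is) p)"
      unfolding step by (intro bexI[of _ "e' i"] exI[of _ e'] conjI allI impI) simp_all
  qed
qed

text \<open>Since \<open>models\<close> quantifies over all assignments, it already performs a universal closure. Hence
  elementary equivalence extends from sentences to arbitrary formulas, and a formula that is
  satisfiable in \<open>G\<close> is satisfiable in \<open>H\<close>.\<close>

lemma models_All: "models G (All i p) \<longleftrightarrow> models G p"
proof
  assume "models G (All i p)"
  then have "\<forall>a\<in>carrier G. sat G (e(i := a)) p" if "range e \<subseteq> carrier G" for e
    using that by (simp add: models_def)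
  from this[THEN bspec] have "sat G (e(i := e i)) p" if "range e \<subseteq> carrier G" for e
    using that by blast
  then show "models G p" by (simp add: models_def)
next
  assume p: "models G p"
  have "sat G (e(i := a)) p" if "range e \<subseteq> carrier G" "a \<in> carrier G" for e a
    using p that unfolding models_def by (auto simp: image_subset_iff)
  then show "models G (All i p)" by (auto simp: models_def)
qed

lemma models_foldr_All: "models G (foldr All vs p) \<longleftrightarrow> models G p"
  by (induction vs) (simp_all add: models_All)

lemma elementarily_equivalent_models:
  assumes "elementarily_equivalent G H"
  shows "models G p \<longleftrightarrow> models H p"
proof -
  obtain vs where vs: "set vs = free_vars p"
    using finite_list[OF finite_free_vars] by blast
  define q where "q = foldr All vs p"
  have *: "models G q \<longleftrightarrow> models G p" "models H q \<longleftrightarrow> models H p"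
    by (simp_all add: q_def models_foldr_All)
  have "free_vars (foldr All vs p) = free_vars p - set vs" for vs
    by (induction vs) auto
  then have "sentence q"
    by (simp add: sentence_def q_def vs)
  with assms * show ?thesis
    by (simp add: elementarily_equivalent_def)
qed

lemma elementarily_equivalent_satisfiable:
  assumes "elementarily_equivalent G H" "range e \<subseteq> carrier G" "sat G e p"
  shows "\<exists>e'. range e' \<subseteq> carrier H \<and> sat H e' p"
  using assms(2,3) elementarily_equivalent_models[OF assms(1), of "Neg p"]
  by (auto simp: models_def)

text \<open>A pair \<open>(p, s)\<close> is a formula with parameters: the variable \<open>i\<close> of \<open>p\<close> stands for the element
  \<open>s i\<close>. Finitely many true conditions with parameters in \<open>G\<close> mention finitely many elements, so they
  can be written as one formula with a common variable for each element. That formula is satisfiable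
  in \<open>G\<close>, hence in \<open>H\<close>, and a satisfying assignment is the map \<open>f\<close>. Different conditions use the same
  variable for different elements, which is why arbitrary renamings of variables are needed.\<close>

lemma finite_realization:
  assumes eq: "elementarily_equivalent G H" and fin: "finite \<Phi>"
    and sat: "\<And>p s. (p, s) \<in> \<Phi> \<Longrightarrow> range s \<subseteq> carrier G \<and> sat G s p"
    and ne: "carrier G \<noteq> {}"
  shows "\<exists>f. range f \<subseteq> carrier H \<and> (\<forall>(p, s)\<in>\<Phi>. sat H (f \<circ> s) p)"
proof -
  obtain a where a: "a \<in> carrier G" using ne by blast
  define F where "F = insert a (\<Union>(p, s)\<in>\<Phi>. s ` free_vars p)"
  have F: "finite F"
    using fin by (auto simp: F_def finite_free_vars)
  have FG: "F \<subseteq> carrier G"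
    unfolding F_def using sat a by blast

  \<comment> \<open>\<open>c x\<close> is the variable that stands for the element \<open>x\<close>, and \<open>e\<close> reads it back.\<close>
  define c where "c = to_nat_on F"
  define e where "e i = (if i \<in> c ` F then inv_into F c i else a)" for i
  have inj: "inj_on c F"
    unfolding c_def by (intro inj_on_to_nat_on countable_finite F)
  have ec: "e (c x) = x" if "x \<in> F" for x
    using that inj by (simp add: e_def)
  have eG: "range e \<subseteq> carrier G"
  proof clarify
    fix i
    show "e i \<in> carrier G"
    proof (cases "i \<in> c ` F")
      case True
      then show ?thesis using ec FG by (metis imageE subsetD)
    next
      case False
      then show ?thesis using a by (simp add: e_def)
    qed
  qed
  obtain L where L: "set L = (\<lambda>(p, s). rename (c \<circ> s) p) ` \<Phi>"
    using finite_list[OF finite_imageI[OF fin]] ..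
  have "sat G e (rename (c \<circ> s) p)" if "(p, s) \<in> \<Phi>" for p s
  proof -
    have "sat G (e \<circ> (c \<circ> s)) p = sat G s p"
    proof (rule sat_cong)
      fix i assume "i \<in> free_vars p"
      then have "s i \<in> F" unfolding F_def using that by auto
      then show "(e \<circ> (c \<circ> s)) i = s i" by (simp add: ec)
    qed
    with sat[OF that] show ?thesis by (simp add: sat_rename)
  qed
  then have "sat G e (Conjs L)" unfolding sat_Conjs L by auto
  then obtain e' where e': "range e' \<subseteq> carrier H" "sat H e' (Conjs L)"
    using elementarily_equivalent_satisfiable[OF eq eG] by blast
  have "sat H (e' \<circ> c \<circ> s) p" if "(p, s) \<in> \<Phi>" for p s
  proof -
    have "sat H e' (rename (c \<circ> s) p)" using e'(2) that unfolding sat_Conjs L by fastforce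
    then show ?thesis by (simp add: sat_rename comp_assoc)
  qed
  then have "\<forall>(p, s)\<in>\<Phi>. sat H (e' \<circ> c \<circ> s) p" by blast
  moreover have "range (e' \<circ> c) \<subseteq> carrier H" using e'(1) by auto
  ultimately show ?thesis by blast
qed

text \<open>The maps from \<open>G\<close> to \<open>H\<close> form a compact space by Tychonoff's theorem. If each condition cuts out a
  closed set of maps, then finite realizability gives the finite intersection property, so all the
  conditions hold for one map.\<close>

lemma compact_realization:
  assumes eq: "elementarily_equivalent G H" and ne: "carrier G \<noteq> {}"
    and T: "compact_space T" "topspace T = carrier H"
    and sat: "\<And>p s. (p, s) \<in> \<Phi> \<Longrightarrow> range s \<subseteq> carrier G \<and> sat G s p"
    and closed: "\<And>p s. (p, s) \<in> \<Phi> \<Longrightarrow> closedin (product_topology (\<lambda>_. T) (carrier G))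
                     {f \<in> carrier G \<rightarrow>\<^sub>E carrier H. sat H (f \<circ> s) p}"
  shows "\<exists>f \<in> carrier G \<rightarrow>\<^sub>E carrier H. \<forall>(p, s)\<in>\<Phi>. sat H (f \<circ> s) p"
proof -
  let ?X = "product_topology (\<lambda>_. T) (carrier G)"
  define C where "C = (\<lambda>(p, s). {f \<in> carrier G \<rightarrow>\<^sub>E carrier H. sat H (f \<circ> s) p})"
  have X: "compact_space ?X"
    using T by (simp add: compact_space_product_topology)
  have realize: "\<exists>f \<in> carrier G \<rightarrow>\<^sub>E carrier H. \<forall>(p, s)\<in>\<Psi>. sat H (f \<circ> s) p" 
    if \<Psi>: "finite \<Psi>" "\<Psi> \<subseteq> \<Phi>" for \<Psi>
  proof -
    have "\<And>p s. (p, s) \<in> \<Psi> \<Longrightarrow> range s \<subseteq> carrier G \<and> sat G s p"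
      using sat \<Psi> by blast
    then obtain f where f: "range f \<subseteq> carrier H" "\<forall>(p, s)\<in>\<Psi>. sat H (f \<circ> s) p"
      using finite_realization[OF eq \<Psi>(1) _ ne] by blast
    have "restrict f (carrier G) \<circ> s = f \<circ> s" if "(p, s) \<in> \<Psi>" for p s
    proof -
      have "s i \<in> carrier G" for i using sat that \<Psi> by blast
      then show ?thesis by (auto simp: fun_eq_iff)
    qed
    with f show ?thesis
      by (intro bexI[of _ "restrict f (carrier G)"]) auto
  qed
  have "\<Inter> (insert (topspace ?X) (C ` \<Phi>)) \<noteq> {}"
  proof (rule compact_space_fip[THEN iffD1, rule_format, OF X], intro conjI ballI allI impI)
    fix D assume "D \<in> insert (topspace ?X) (C ` \<Phi>)"
    then show "closedin ?X D"
      using closed closedin_topspace[of ?X]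
      by (auto simp: C_def simp del: topspace_product_topology)
  next
    fix \<F> assume \<F>: "finite \<F> \<and> \<F> \<subseteq> insert (topspace ?X) (C ` \<Phi>)"
    then have "\<F> - {topspace ?X} \<subseteq> C ` \<Phi>" "finite (\<F> - {topspace ?X})" by auto
    then obtain \<Psi> where \<Psi>: "\<Psi> \<subseteq> \<Phi>" "finite \<Psi>" "\<F> - {topspace ?X} = C ` \<Psi>"
      by (metis finite_subset_image)
    obtain f where f: "f \<in> carrier G \<rightarrow>\<^sub>E carrier H" "\<forall>(p, s)\<in>\<Psi>. sat H (f \<circ> s) p"
      using realize[OF \<Psi>(2,1)] by blast
    have "f \<in> D" if "D \<in> \<F>" for D
    proof (cases "D = topspace ?X")
      case True
      then show ?thesis using f T by simp
    next
      case False
      then have "D \<in> C ` \<Psi>" using that \<Psi> by blast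
      then show ?thesis using f by (auto simp: C_def)
    qed
    then show "\<Inter> \<F> \<noteq> {}" by blast
  qed
  then show ?thesis
    by (auto simp: C_def T)
qed


section \<open>Verbal subgroups\<close>

definition word_values :: "('a, 'x) monoid_scheme \<Rightarrow> nat \<Rightarrow> gword \<Rightarrow> 'a set" where
  "word_values G n w = {word_val G g w | g. g \<in> {..<n} \<rightarrow> carrier G}"

definition signed_word_values :: "('a, 'x) monoid_scheme \<Rightarrow> nat \<Rightarrow> gword \<Rightarrow> 'a set" where
  "signed_word_values G n w = word_values G n w \<union> m_inv G ` word_values G n w"

text \<open>The ball of radius \<open>m\<close> about \<open>\<one>\<close> in the Cayley graph of \<open>w(G)\<close> with respect to the values of \<open>w\<close>.
  Each ball is compact and definable, whereas \<open>w(G)\<close> is only the union of all balls.\<close>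

primrec verbal_ball :: "('a, 'x) monoid_scheme \<Rightarrow> nat \<Rightarrow> gword \<Rightarrow> nat \<Rightarrow> 'a set" where
  "verbal_ball G n w 0 = {\<one>\<^bsub>G\<^esub>}"
| "verbal_ball G n w (Suc m) = verbal_ball G n w m <#>\<^bsub>G\<^esub> signed_word_values G n w"

lemma verbal_subgroup_eq: "verbal_subgroup G n w = generate G (word_values G n w)"
  by (simp add: verbal_subgroup_def word_values_def)

lemma group_words_letters: "w \<in> group_words n \<Longrightarrow> fst ` set w \<subseteq> {..<n}"
  by (simp add: group_words_def)

lemma word_val_cong:
  assumes "\<And>i. i \<in> fst ` set w \<Longrightarrow> g i = h i"
  shows "word_val G g w = word_val G h w"
  using assms by (induction w) auto

context group
begin

lemma word_val_closed:
  assumes "\<And>i. i \<in> fst ` set w \<Longrightarrow> g i \<in> carrier G"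
  shows "word_val G g w \<in> carrier G"
  using assms by (induction w) auto

lemma word_val_one: "word_val G (\<lambda>_. \<one>) w = \<one>"
  by (induction w) auto

lemma word_val_hom:
  assumes "group_hom G K \<phi>" "\<And>i. i \<in> fst ` set w \<Longrightarrow> g i \<in> carrier G"
  shows "\<phi> (word_val G g w) = word_val K (\<phi> \<circ> g) w"
proof -
  interpret \<phi>: group_hom G K \<phi> by fact
  show ?thesis using assms(2)
  proof (induction w)
    case (Cons l w)
    then have "word_val G g w \<in> carrier G" by (intro word_val_closed) auto
    with Cons show ?case by auto
  qed simp
qed

lemma word_values_subset: "w \<in> group_words n \<Longrightarrow> word_values G n w \<subseteq> carrier G"
  using group_words_letters[of w n] by (fastforce simp: word_values_def intro!: word_val_closed)

lemma one_in_word_values: "\<one> \<in> word_values G n w"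
  unfolding word_values_def by (intro CollectI exI[of _ "\<lambda>_. \<one>"]) (simp add: word_val_one)

lemma verbal_subgroup_is_subgroup: "w \<in> group_words n \<Longrightarrow> subgroup (verbal_subgroup G n w) G"
  unfolding verbal_subgroup_eq by (rule generate_is_subgroup[OF word_values_subset])

lemma signed_word_values_subset: "w \<in> group_words n \<Longrightarrow> signed_word_values G n w \<subseteq> carrier G"
  using word_values_subset by (auto simp: signed_word_values_def)

lemma one_in_signed_word_values: "\<one> \<in> signed_word_values G n w"
  using one_in_word_values by (simp add: signed_word_values_def)

lemma verbal_ball_subset: "w \<in> group_words n \<Longrightarrow> verbal_ball G n w m \<subseteq> carrier G"
  by (induction m) (auto simp: set_mult_closed signed_word_values_subset)

lemma verbal_ball_add:
  assumes "w \<in> group_words n" "x \<in> verbal_ball G n w k" "y \<in> verbal_ball G n w m"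
  shows "x \<otimes> y \<in> verbal_ball G n w (k + m)"
  using assms(3)
proof (induction m arbitrary: y)
  case 0
  then show ?case using verbal_ball_subset[OF assms(1), of k] assms(2) by auto
next
  case (Suc m)
  then obtain z u where zu: "z \<in> verbal_ball G n w m" "u \<in> signed_word_values G n w" "y = z \<otimes> u"
    by (auto simp: set_mult_def)
  then have "x \<otimes> y = x \<otimes> z \<otimes> u"
    using assms(1,2) verbal_ball_subset signed_word_values_subset m_assoc by (metis subsetD)
  then show ?case using Suc.IH[OF zu(1)] zu(2) by (auto simp: set_mult_def)
qed

lemma verbal_ball_mono:
  assumes "w \<in> group_words n" "k \<le> m"
  shows "verbal_ball G n w k \<subseteq> verbal_ball G n w m"
proof (rule lift_Suc_mono_le[OF _ assms(2)])
  fix i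
  show "verbal_ball G n w i \<subseteq> verbal_ball G n w (Suc i)"
  proof
    fix x assume "x \<in> verbal_ball G n w i"
    moreover from this have "x = x \<otimes> \<one>" using verbal_ball_subset[OF assms(1), of i] by auto
    ultimately show "x \<in> verbal_ball G n w (Suc i)"
      using one_in_signed_word_values by (auto simp: set_mult_def)
  qed
qed

lemma signed_word_values_subset_ball: "w \<in> group_words n \<Longrightarrow> signed_word_values G n w \<subseteq> verbal_ball G n w 1"
  using signed_word_values_subset by (force simp: set_mult_def)

lemma verbal_subgroup_UN:
  assumes w: "w \<in> group_words n"
  shows "verbal_subgroup G n w = (\<Union>m. verbal_ball G n w m)"
proof
  show "verbal_subgroup G n w \<subseteq> (\<Union>m. verbal_ball G n w m)"
  proof
    fix x assume "x \<in> verbal_subgroup G n w"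
    then have "x \<in> generate G (word_values G n w)" by (simp add: verbal_subgroup_eq)
    then show "x \<in> (\<Union>m. verbal_ball G n w m)"
    proof induction
      case one
      then show ?case by (auto intro: exI[of _ 0])
    next
      case (incl h)
      then have "h \<in> verbal_ball G n w 1"
        using signed_word_values_subset_ball[OF w] unfolding signed_word_values_def by blast
      then show ?case by blast
    next
      case (inv h)
      then have "inv h \<in> verbal_ball G n w 1"
        using signed_word_values_subset_ball[OF w] unfolding signed_word_values_def by blast
      then show ?case by blast
    next
      case (eng h1 h2)
      then show ?case using verbal_ball_add[OF w] by blast
    qed
  qed
next
  interpret V: subgroup "verbal_subgroup G n w" G
    by (rule verbal_subgroup_is_subgroup[OF w])
  have l: "signed_word_values G n w \<subseteq> verbal_subgroup G n w"
    unfolding verbal_subgroup_eq signed_word_values_def by (auto intro: generate.incl generate.inv)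
  have "verbal_ball G n w m \<subseteq> verbal_subgroup G n w" for m
    by (induction m) (use l in \<open>auto simp: set_mult_def\<close>)
  then show "(\<Union>m. verbal_ball G n w m) \<subseteq> verbal_subgroup G n w" by blast
qed

text \<open>The inclusion of one ball in another is a first-order property, unlike the equality that follows
  from it. This is how a bound on the width passes to elementarily equivalent groups.\<close>

lemma verbal_subgroup_eq_ball:
  assumes w: "w \<in> group_words n"
    and stable: "verbal_ball G n w (Suc M) \<subseteq> verbal_ball G n w M"
  shows "verbal_subgroup G n w = verbal_ball G n w M"
proof -
  have step: "verbal_ball G n w (Suc m) \<subseteq> verbal_ball G n w M"
    if "verbal_ball G n w m \<subseteq> verbal_ball G n w M" for m
  proof -
    have "verbal_ball G n w (Suc m) \<subseteq> verbal_ball G n w (Suc M)"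
      using mono_set_mult[OF that subset_refl] by simp
    with stable show ?thesis by blast
  qed
  have "verbal_ball G n w m \<subseteq> verbal_ball G n w M" for m
  proof (induction m)
    case 0
    show ?case by (rule verbal_ball_mono[OF w]) simp
  qed (rule step)
  then show ?thesis unfolding verbal_subgroup_UN[OF w] by blast
qed

text \<open>A homomorphism commutes with the evaluation of words. If \<open>w\<close> vanishes on the target, this puts
  \<open>w(G)\<close> into the kernel.\<close>

lemma hom_verbal_subgroup:
  assumes \<phi>: "group_hom G K \<phi>" and w: "w \<in> group_words n" and x: "x \<in> verbal_subgroup G n w"
  shows "\<phi> x \<in> verbal_subgroup K n w"
proof -
  interpret \<phi>: group_hom G K \<phi> by fact
  have vals: "v \<in> carrier G \<and> \<phi> v \<in> word_values K n w" if v: "v \<in> word_values G n w" for v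
  proof -
    obtain g where g: "g \<in> {..<n} \<rightarrow> carrier G" "v = word_val G g w"
      using v by (auto simp: word_values_def)
    then have gi: "g i \<in> carrier G" if "i \<in> fst ` set w" for i
      using that group_words_letters[OF w] by blast
    have "\<phi> v = word_val K (\<phi> \<circ> g) w"
      unfolding g(2) by (rule word_val_hom[OF \<phi> gi])
    moreover have "\<phi> \<circ> g \<in> {..<n} \<rightarrow> carrier K"
      using g(1) by (auto intro!: \<phi>.hom_closed)
    ultimately show ?thesis
      using word_values_subset[OF w] v unfolding word_values_def by blast
  qed
  from x have "x \<in> generate G (word_values G n w)" by (simp add: verbal_subgroup_eq)
  then have "x \<in> carrier G \<and> \<phi> x \<in> generate K (word_values K n w)"
    by induction (use vals in \<open>auto intro: generate.intros\<close>)
  then show ?thesis by (simp add: verbal_subgroup_eq)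
qed

lemma verbal_subgroup_subset_kernel:
  assumes \<phi>: "group_hom G K \<phi>" and w: "w \<in> group_words n"
    and triv: "verbal_subgroup K n w = {\<one>\<^bsub>K\<^esub>}"
  shows "verbal_subgroup G n w \<subseteq> kernel G K \<phi>"
  using hom_verbal_subgroup[OF \<phi> w] triv subgroup.subset[OF verbal_subgroup_is_subgroup[OF w]]
  by (auto simp: kernel_def)

end


section \<open>Verbal balls are first-order definable\<close>

primrec word_term :: "nat \<Rightarrow> gword \<Rightarrow> gterm" where
  "word_term k [] = One"
| "word_term k (l # w) =
     Mult (if snd l then Var (k + fst l) else Inv (Var (k + fst l))) (word_term k w)"

lemma term_val_word_term: "term_val G e (word_term k w) = word_val G (\<lambda>i. e (k + i)) w"
  by (induction w) auto

text \<open>The formulas define relations between two group elements, the values of the variables \<open>0\<close> and \<open>1\<close>,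
  namely \<open>inv x \<otimes> y \<in> B\<close> for the set \<open>B\<close> in question. In this form a product of sets becomes a
  composition of relations, which needs one auxiliary variable \<open>2\<close>. Here the variables from \<open>2\<close> on are
  the arguments of the word.\<close>

definition signed_value_formula :: "nat \<Rightarrow> gword \<Rightarrow> gformula" where
  "signed_value_formula n w = Exists_list [2..<2 + n]
     (Disj (Eq (Var 1) (Mult (Var 0) (word_term 2 w))) (Eq (Var 0) (Mult (Var 1) (word_term 2 w))))"

primrec ball_formula :: "nat \<Rightarrow> gword \<Rightarrow> nat \<Rightarrow> gformula" where
  "ball_formula n w 0 = Eq (Var 0) (Var 1)"
| "ball_formula n w (Suc m) =
     Exists 2 (Conj (rename (id(1 := 2)) (ball_formula n w m)) (rename (id(0 := 2)) (signed_value_formula n w)))"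

text \<open>The left translates of the ball by the variables \<open>0, \<dots>, k - 1\<close> cover the group; the variable \<open>k\<close>
  runs over all elements.\<close>

definition cover_formula :: "nat \<Rightarrow> gword \<Rightarrow> nat \<Rightarrow> nat \<Rightarrow> gformula" where
  "cover_formula n w m k =
     All k (Disjs (map (\<lambda>i. rename ((\<lambda>_. k)(0 := i)) (ball_formula n w m)) [0..<k]))"

context group
begin

lemma sat_signed_value_formula:
  assumes w: "w \<in> group_words n" and e: "range e \<subseteq> carrier G"
  shows "sat G e (signed_value_formula n w) \<longleftrightarrow> inv (e 0) \<otimes> e 1 \<in> signed_word_values G n w"
proof -
  have eG: "e i \<in> carrier G" for i using e by auto
  have inv_iff: "y = x \<otimes> v \<longleftrightarrow> inv x \<otimes> y = v" "x = y \<otimes> v \<longleftrightarrow> inv x \<otimes> y = inv v"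
    if "x \<in> carrier G" "y \<in> carrier G" "v \<in> carrier G" for x y v
    using that by (metis inv_closed inv_solve_left m_closed, metis inv_closed inv_inv inv_mult_group inv_solve_left m_closed)
  have "sat G e (signed_value_formula n w) \<longleftrightarrow> (\<exists>e'. range e' \<subseteq> carrier G \<and>
      (\<forall>j. j \<notin> {2..<2 + n} \<longrightarrow> e' j = e j) \<and>
      (e' 1 = e' 0 \<otimes> word_val G (\<lambda>i. e' (2 + i)) w \<or> e' 0 = e' 1 \<otimes> word_val G (\<lambda>i. e' (2 + i)) w))"
    unfolding signed_value_formula_def sat_Exists_list[OF e]
    by (simp only: sat_Disj sat.simps term_val.simps term_val_word_term set_upt)
  also have "\<dots> \<longleftrightarrow> (\<exists>v\<in>word_values G n w. e 1 = e 0 \<otimes> v \<or> e 0 = e 1 \<otimes> v)" (is "?L \<longleftrightarrow> ?R")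
  proof
    assume ?L
    then obtain e' where e': "range e' \<subseteq> carrier G" "\<And>j. j \<notin> {2..<2 + n} \<Longrightarrow> e' j = e j"
      "e' 1 = e' 0 \<otimes> word_val G (\<lambda>i. e' (2 + i)) w \<or> e' 0 = e' 1 \<otimes> word_val G (\<lambda>i. e' (2 + i)) w"
      by blast
    have "word_val G (\<lambda>i. e' (2 + i)) w \<in> word_values G n w"
      unfolding word_values_def using e'(1) by blast
    then show ?R using e'(2)[of 0] e'(2)[of 1] e'(3) by auto
  next
    assume ?R
    then obtain g where g: "g \<in> {..<n} \<rightarrow> carrier G"
      "e 1 = e 0 \<otimes> word_val G g w \<or> e 0 = e 1 \<otimes> word_val G g w"
      unfolding word_values_def by blast
    define e' where "e' j = (if j \<in> {2..<2 + n} then g (j - 2) else e j)" for j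
    have "word_val G (\<lambda>i. e' (2 + i)) w = word_val G g w"
      by (rule word_val_cong) (use group_words_letters[OF w] in \<open>auto simp: e'_def\<close>)
    moreover have "range e' \<subseteq> carrier G" using g(1) eG by (auto simp: e'_def)
    moreover have "e' 0 = e 0" "e' 1 = e 1" by (auto simp: e'_def)
    ultimately show ?L using g(2) by (intro exI[of _ e']) (simp add: e'_def)
  qed
  also have "\<dots> \<longleftrightarrow> (\<exists>v\<in>word_values G n w. inv (e 0) \<otimes> e 1 = v \<or> inv (e 0) \<otimes> e 1 = inv v)"
    using inv_iff[OF eG eG] word_values_subset[OF w] by (intro bex_cong refl) blast
  also have "\<dots> \<longleftrightarrow> inv (e 0) \<otimes> e 1 \<in> signed_word_values G n w"
    unfolding signed_word_values_def by blast
  finally show ?thesis .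
qed

lemma sat_ball_formula:
  assumes w: "w \<in> group_words n" and e: "range e \<subseteq> carrier G"
  shows "sat G e (ball_formula n w m) \<longleftrightarrow> inv (e 0) \<otimes> e 1 \<in> verbal_ball G n w m"
  using e
proof (induction m arbitrary: e)
  case 0
  then have "e 0 \<in> carrier G" "e 1 \<in> carrier G" by auto
  then have "e 0 = e 1 \<longleftrightarrow> inv (e 0) \<otimes> e 1 = \<one>"
    by (metis inv_closed inv_equality inv_inv l_inv)
  then show ?case by simp
next
  case (Suc m)
  then have e01: "e 0 \<in> carrier G" "e 1 \<in> carrier G" by auto
  have "sat G e (ball_formula n w (Suc m)) \<longleftrightarrow> (\<exists>z\<in>carrier G.
      inv (e 0) \<otimes> z \<in> verbal_ball G n w m \<and> inv z \<otimes> e 1 \<in> signed_word_values G n w)"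
  proof -
    have "sat G (e(2 := z) \<circ> id(1 := 2)) (ball_formula n w m) \<longleftrightarrow> inv (e 0) \<otimes> z \<in> verbal_ball G n w m"
      if "z \<in> carrier G" for z
      by (subst Suc.IH) (use Suc.prems that in auto)
    moreover have "sat G (e(2 := z) \<circ> id(0 := 2)) (signed_value_formula n w) \<longleftrightarrow> inv z \<otimes> e 1 \<in> signed_word_values G n w"
      if "z \<in> carrier G" for z
      by (subst sat_signed_value_formula[OF w]) (use Suc.prems that in auto)
    ultimately show ?thesis by (simp add: sat_rename)
  qed
  also have "\<dots> \<longleftrightarrow> inv (e 0) \<otimes> e 1 \<in> verbal_ball G n w (Suc m)" (is "?L \<longleftrightarrow> ?R")
  proof
    assume ?L
    then obtain z where z: "z \<in> carrier G" "inv (e 0) \<otimes> z \<in> verbal_ball G n w m"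
      "inv z \<otimes> e 1 \<in> signed_word_values G n w" by blast
    have "(inv (e 0) \<otimes> z) \<otimes> (inv z \<otimes> e 1) = inv (e 0) \<otimes> e 1"
      using e01 z(1) by (metis inv_closed inv_solve_left m_assoc m_closed)
    then show ?R
      unfolding verbal_ball.simps set_mult_def by (intro UN_I[OF z(2)] UN_I[OF z(3)]) simp
  next
    assume ?R
    then obtain p u where pu: "p \<in> verbal_ball G n w m" "u \<in> signed_word_values G n w"
      "inv (e 0) \<otimes> e 1 = p \<otimes> u"
      unfolding verbal_ball.simps set_mult_def by blast
    have c: "p \<in> carrier G" "u \<in> carrier G"
      using pu verbal_ball_subset[OF w] signed_word_values_subset[OF w] by auto
    have "inv (e 0) \<otimes> (e 0 \<otimes> p) = p" using e01 c by (simp add: m_assoc[symmetric])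
    moreover have "inv (e 0 \<otimes> p) \<otimes> e 1 = u"
      using e01 c pu(3) by (metis inv_closed inv_mult_group inv_solve_left m_assoc m_closed)
    ultimately show ?L using pu e01 c by (intro bexI[of _ "e 0 \<otimes> p"]) auto
  qed
  finally show ?case .
qed

lemma sat_cover_formula:
  assumes w: "w \<in> group_words n" and e: "range e \<subseteq> carrier G"
  shows "sat G e (cover_formula n w m k) \<longleftrightarrow>
           (\<forall>y\<in>carrier G. \<exists>i<k. inv (e i) \<otimes> y \<in> verbal_ball G n w m)"
proof -
  have "sat G (e(k := y) \<circ> (\<lambda>_. k)(0 := i)) (ball_formula n w m) \<longleftrightarrow>
      inv (e i) \<otimes> y \<in> verbal_ball G n w m" if "y \<in> carrier G" "i < k" for y i
    by (subst sat_ball_formula[OF w]) (use that e in auto)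
  then show ?thesis by (auto simp: cover_formula_def sat_rename Bex_def)
qed

end


section \<open>Open subgroups and verbal subgroups of profinite groups\<close>

context profinite_group
begin

lemma continuous_map_mult:
  assumes "continuous_map X T f" "continuous_map X T g"
  shows "continuous_map X T (\<lambda>x. f x \<otimes> g x)"
proof -
  have "continuous_map X (prod_topology T T) (\<lambda>x. (f x, g x))"
    using assms by (simp add: continuous_map_pairedI)
  from continuous_map_compose[OF this continuous_mult] show ?thesis
    by (simp add: comp_def)
qed

lemma continuous_map_inv:
  assumes "continuous_map X T f"
  shows "continuous_map X T (\<lambda>x. inv (f x))"
  using continuous_map_compose[OF assms continuous_inv] by (simp add: comp_def)

lemma continuous_map_word_val:
  assumes "\<And>i. i \<in> fst ` set w \<Longrightarrow> continuous_map X T (\<lambda>x. g x i)"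
  shows "continuous_map X T (\<lambda>x. word_val G (g x) w)"
  using assms
proof (induction w)
  case Nil
  then show ?case by (simp add: topspace_eq)
next
  case (Cons l w)
  have l: "continuous_map X T (\<lambda>x. g x (fst l))" using Cons.prems by simp
  have w: "continuous_map X T (\<lambda>x. word_val G (g x) w)" using Cons by simp
  show ?case
  proof (cases "snd l")
    case True
    then show ?thesis using continuous_map_mult[OF l w] by simp
  next
    case False
    then show ?thesis using continuous_map_mult[OF continuous_map_inv[OF l] w] by simp
  qed
qed

lemma translate_eq: 
  assumes "x \<in> carrier G" "A \<subseteq> carrier G"
  shows "l_coset G x A = {y \<in> topspace T. inv x \<otimes> y \<in> A}"
proof
  show "l_coset G x A \<subseteq> {y \<in> topspace T. inv x \<otimes> y \<in> A}"
    using assms by (auto simp: l_coset_def topspace_eq m_assoc[symmetric] subset_iff)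
  show "{y \<in> topspace T. inv x \<otimes> y \<in> A} \<subseteq> l_coset G x A"
  proof clarify
    fix y assume y: "y \<in> topspace T" "inv x \<otimes> y \<in> A"
    then have "y = x \<otimes> (inv x \<otimes> y)"
      using assms by (simp add: topspace_eq m_assoc[symmetric])
    then show "y \<in> l_coset G x A" using y(2) by (auto simp: l_coset_def)
  qed
qed

lemma continuous_map_translate: "x \<in> carrier G \<Longrightarrow> continuous_map T T (\<lambda>y. x \<otimes> y)"
  by (intro continuous_map_mult) (auto simp: topspace_eq)

lemma openin_translate:
  assumes "x \<in> carrier G" "openin T A"
  shows "openin T (l_coset G x A)"
proof -
  have "A \<subseteq> carrier G" using openin_subset[OF assms(2)] topspace_eq by simp
  then show ?thesis
    using assms continuous_map_translate[of "inv x"]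
    by (simp add: translate_eq openin_continuous_map_preimage)
qed

lemma closedin_translate:
  assumes "x \<in> carrier G" "closedin T A"
  shows "closedin T (l_coset G x A)"
proof -
  have "A \<subseteq> carrier G" using closedin_subset[OF assms(2)] topspace_eq by simp
  then show ?thesis
    using assms continuous_map_translate[of "inv x"]
    by (simp add: translate_eq closedin_continuous_map_preimage)
qed

lemma compactin_set_mult:
  assumes "compactin T A" "compactin T B"
  shows "compactin T (A <#> B)"
proof -
  have "compactin (prod_topology T T) (A \<times> B)" using assms by (simp add: compactin_Times)
  from image_compactin[OF this continuous_mult] have "compactin T ((\<lambda>(x, y). x \<otimes> y) ` (A \<times> B))" .
  moreover have "(\<lambda>(x, y). x \<otimes> y) ` (A \<times> B) = A <#> B"
    by (auto simp: set_mult_def)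
  ultimately show ?thesis by simp
qed

lemma compactin_word_values:
  assumes w: "w \<in> group_words n"
  shows "compactin T (word_values G n w)"
proof -
  let ?P = "product_topology (\<lambda>_. T) {..<n}"
  have "continuous_map ?P T (\<lambda>g. word_val G g w)"
    using group_words_letters[OF w]
    by (intro continuous_map_word_val continuous_map_product_projection) auto
  moreover have "compactin ?P (topspace ?P)"
    using compact compact_space_product_topology[of "\<lambda>_. T" "{..<n}"]
    by (simp only: compact_space_def) blast
  ultimately have "compactin T ((\<lambda>g. word_val G g w) ` topspace ?P)"
    by (metis image_compactin)
  moreover have "(\<lambda>g. word_val G g w) ` topspace ?P = word_values G n w"
  proof
    show "(\<lambda>g. word_val G g w) ` topspace ?P \<subseteq> word_values G n w"
      by (auto simp: word_values_def topspace_eq)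
    show "word_values G n w \<subseteq> (\<lambda>g. word_val G g w) ` topspace ?P"
    proof
      fix x assume "x \<in> word_values G n w"
      then obtain g where g: "g \<in> {..<n} \<rightarrow> carrier G" "x = word_val G g w"
        by (auto simp: word_values_def)
      have "word_val G g w = word_val G (restrict g {..<n}) w"
        by (rule word_val_cong) (use group_words_letters[OF w] in auto)
      then show "x \<in> (\<lambda>g. word_val G g w) ` topspace ?P"
        using g by (auto simp: topspace_eq intro!: image_eqI[of _ _ "restrict g {..<n}"])
    qed
  qed
  ultimately show ?thesis by simp
qed

lemma compactin_verbal_ball:
  assumes w: "w \<in> group_words n"
  shows "compactin T (verbal_ball G n w m)"
proof (induction m)
  case 0
  then show ?case by (simp add: topspace_eq)
next
  case (Suc m)
  have "compactin T (signed_word_values G n w)"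
    unfolding signed_word_values_def
    by (intro compactin_Un compactin_word_values[OF w] image_compactin[OF _ continuous_inv])
  then show ?case using Suc.IH by (simp add: compactin_set_mult)
qed

lemma closedin_verbal_ball: "w \<in> group_words n \<Longrightarrow> closedin T (verbal_ball G n w m)"
  by (rule compactin_imp_closedin[OF Hausdorff compactin_verbal_ball])

lemma mem_coset_iff:
  assumes "subgroup W G" "x \<in> carrier G" "y \<in> carrier G"
  shows "y \<in> l_coset G x W \<longleftrightarrow> inv x \<otimes> y \<in> W"
  using translate_eq[OF assms(2) subgroup.subset[OF assms(1)]] assms(3) by (simp add: topspace_eq)

text \<open>Complements of subgroups are unions of cosets. This makes open subgroups closed, and closed
  subgroups of finite index open.\<close>

lemma coset_complement:
  assumes "subgroup W G" and F: "F \<subseteq> carrier G" "carrier G \<subseteq> (\<Union>x\<in>F. l_coset G x W)"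
  shows "carrier G - W = (\<Union>x\<in>F - W. l_coset G x W)"
proof -
  interpret W: subgroup W G by fact
  have *: "l_coset G x W = W" if "x \<in> W" for x 
    using coset_join3[OF W.mem_carrier[OF that] assms(1) that] .
  have disj: "l_coset G x W \<inter> W = {}" if "x \<in> carrier G" "x \<notin> W" for x
  proof -
    have False if "y \<in> W" "y \<in> l_coset G x W" for y
    proof -
      have "inv x \<otimes> y \<in> W"
        using that mem_coset_iff[OF assms(1) \<open>x \<in> carrier G\<close>] by simp
      then have "inv x \<otimes> y \<otimes> inv y \<in> W" using that by blast
      then have "inv x \<in> W" using that \<open>x \<in> carrier G\<close> by (simp add: m_assoc)
      then show False using \<open>x \<notin> W\<close> \<open>x \<in> carrier G\<close> by (metis W.m_inv_closed inv_inv)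
    qed
    then show ?thesis by blast
  qed
  have sub: "l_coset G x W \<subseteq> carrier G" if "x \<in> F" for x
    using that F by (intro l_coset_subset_G W.subset) auto
  show ?thesis
  proof (intro equalityI subsetI)
    fix y assume y: "y \<in> carrier G - W"
    then obtain x where x: "x \<in> F" "y \<in> l_coset G x W" using F by auto
    then have "x \<notin> W" using y * by auto
    then show "y \<in> (\<Union>x\<in>F - W. l_coset G x W)" using x by auto
  next
    fix y assume "y \<in> (\<Union>x\<in>F - W. l_coset G x W)"
    then obtain x where x: "x \<in> F" "x \<notin> W" "y \<in> l_coset G x W" by auto
    with F have "x \<in> carrier G" by auto
    with x show "y \<in> carrier G - W" using disj[of x] sub[of x] by auto
  qed
qed

lemma carrier_subset_cosets:
  assumes "subgroup W G"
  shows "carrier G \<subseteq> (\<Union>x\<in>carrier G. l_coset G x W)"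
proof
  fix y assume "y \<in> carrier G"
  then show "y \<in> (\<Union>x\<in>carrier G. l_coset G x W)"
    using mem_coset_iff[OF assms, of y y] subgroup.one_closed[OF assms] by auto
qed

lemma open_subgroup_closed:
  assumes "subgroup W G" "openin T W"
  shows "closedin T W"
proof -
  have "openin T (carrier G - W)"
    by (subst coset_complement[OF assms(1) subset_refl carrier_subset_cosets[OF assms(1)]], rule openin_Union) (use assms(2) openin_translate in blast)
  then show ?thesis
    using openin_subset[OF assms(2)] by (simp add: closedin_def topspace_eq)
qed

lemma closed_subgroup_open:
  assumes "subgroup W G" "closedin T W" "finite F" "F \<subseteq> carrier G" "carrier G \<subseteq> (\<Union>x\<in>F. l_coset G x W)"
  shows "openin T W"
proof -
  have "closedin T (carrier G - W)"
    by (subst coset_complement[OF assms(1,4,5)], rule closedin_Union) (use assms(2-4) closedin_translate in auto)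
  then show ?thesis
    using closedin_subset[OF assms(2)] by (simp add: openin_closedin topspace_eq)
qed

lemma open_subgroup_finite_cover:
  assumes "subgroup W G" "openin T W"
  shows "\<exists>F. finite F \<and> F \<subseteq> carrier G \<and> carrier G \<subseteq> (\<Union>x\<in>F. l_coset G x W)"
proof -
  have "\<exists>\<F>. finite \<F> \<and> \<F> \<subseteq> (\<lambda>x. l_coset G x W) ` carrier G \<and> topspace T \<subseteq> \<Union>\<F>"
    using compact[unfolded compact_space_alt, rule_format, of "(\<lambda>x. l_coset G x W) ` carrier G"]
      carrier_subset_cosets[OF assms(1)] openin_translate assms(2) by (auto simp: topspace_eq)
  then show ?thesis
    unfolding topspace_eq by (metis finite_subset_image)
qed

text \<open>An open verbal subgroup has finite width. It is a countable union of the compact balls, so by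
  Baire's theorem some ball has an interior point; translates of its interior cover the compact group
  \<open>w(G)\<close>, finitely many of them suffice, and the translating elements lie in a common ball.\<close>

lemma open_verbal_subgroup_eq_ball:
  assumes w: "w \<in> group_words n" and op: "openin T (verbal_subgroup G n w)"
  shows "\<exists>M. verbal_subgroup G n w = verbal_ball G n w M"
proof -
  let ?W = "verbal_subgroup G n w"
  have sub: "subgroup ?W G" by (rule verbal_subgroup_is_subgroup[OF w])
  interpret W: subgroup ?W G by (rule sub)
  have "T interior_of ?W = ?W" using op by (simp add: interior_of_openin)
  then have ne: "T interior_of (\<Union> (range (verbal_ball G n w))) \<noteq> {}"
    using W.one_closed verbal_subgroup_UN[OF w] by auto
  have "\<exists>m. T interior_of verbal_ball G n w m \<noteq> {}"
  proof (rule ccontr)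
    assume *: "\<nexists>m. T interior_of verbal_ball G n w m \<noteq> {}"
    have "T interior_of (\<Union> (range (verbal_ball G n w))) = {}"
      by (rule Baire_category_alt)
        (use * closedin_verbal_ball[OF w] compact Hausdorff compact_imp_locally_compact_space
          compact_Hausdorff_imp_regular_space in auto)
    with ne show False by blast
  qed
  then obtain m where m: "T interior_of verbal_ball G n w m \<noteq> {}" by blast
  define U where "U = T interior_of verbal_ball G n w m"
  have U: "openin T U" "U \<subseteq> verbal_ball G n w m" "U \<subseteq> carrier G"
    using interior_of_subset[of T] openin_subset[of T U] by (auto simp: U_def topspace_eq)
  obtain u where u: "u \<in> U" using m U_def by blast
  then have uW: "u \<in> ?W" using U(2) verbal_subgroup_UN[OF w] by auto
  have "compactin T ?W"
    by (rule closedin_compact_space[OF compact open_subgroup_closed[OF sub op]])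
  moreover have "\<And>A. A \<in> (\<lambda>x. l_coset G x U) ` ?W \<Longrightarrow> openin T A"
    using U(1) by (auto intro: openin_translate)
  moreover have "?W \<subseteq> \<Union> ((\<lambda>x. l_coset G x U) ` ?W)"
  proof
    fix y assume y: "y \<in> ?W"
    then have "y = (y \<otimes> inv u) \<otimes> u" "y \<otimes> inv u \<in> ?W" using uW by (auto simp: m_assoc)
    then show "y \<in> \<Union> ((\<lambda>x. l_coset G x U) ` ?W)" using u unfolding l_coset_def by blast
  qed
  ultimately obtain \<F> where \<F>: "finite \<F>" "\<F> \<subseteq> (\<lambda>x. l_coset G x U) ` ?W" "?W \<subseteq> \<Union>\<F>"
    unfolding compactin_def by meson
  then obtain F where F: "finite F" "F \<subseteq> ?W" "?W \<subseteq> (\<Union>x\<in>F. l_coset G x U)"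
    by (metis finite_subset_image)
  have "\<exists>k. F \<subseteq> verbal_ball G n w k"
    using F(1,2)
  proof induction
    case (insert x F)
    then obtain k l where "F \<subseteq> verbal_ball G n w k" "x \<in> verbal_ball G n w l"
      using verbal_subgroup_UN[OF w] by auto
    then have "insert x F \<subseteq> verbal_ball G n w (max k l)"
      using verbal_ball_mono[OF w max.cobounded1[of k l]] verbal_ball_mono[OF w max.cobounded2[of l k]]
      by auto
    then show ?case ..
  qed simp
  then obtain k where k: "F \<subseteq> verbal_ball G n w k" ..
  have "?W \<subseteq> verbal_ball G n w (k + m)"
  proof
    fix y assume "y \<in> ?W"
    then obtain x z where "x \<in> F" "z \<in> U" "y = x \<otimes> z"
      using F(3) unfolding l_coset_def by blast
    then show "y \<in> verbal_ball G n w (k + m)"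
      using verbal_ball_add[OF w, of x k z m] k U(2) by blast
  qed
  then show ?thesis using verbal_subgroup_UN[OF w] by blast
qed

text \<open>In a compact Hausdorff space a connected component, here a point, can be separated from any
  disjoint closed set by a clopen set.\<close>

lemma clopen_neighbourhood:
  assumes "openin T A" "x \<in> A"
  shows "\<exists>K. openin T K \<and> closedin T K \<and> x \<in> K \<and> K \<subseteq> A"
proof -
  have x: "x \<in> topspace T" using assms openin_subset by blast
  define C where "C = connected_component_of_set T x"
  have "connectedin T C" by (simp add: C_def connectedin_connected_component_of)
  then obtain z where "C \<subseteq> {z}" using totally_disconnected by blast
  moreover have "x \<in> C" using x by (simp add: C_def connected_component_of_refl)
  ultimately have C: "C = {x}" by auto
  have "C \<in> connected_components_of T"
    using x by (auto simp: C_def connected_components_of_def)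
  then have "separated_between T C (topspace T - A)"
    using separated_between_compact_connected_component[OF
        compact_imp_locally_compact_space[OF compact] Hausdorff, of C "topspace T - A"]
      assms C x by (auto simp: disjnt_def)
  then obtain K L where KL: "openin T K" "openin T L" "K \<union> L = topspace T" "disjnt K L"
    "C \<subseteq> K" "topspace T - A \<subseteq> L"
    unfolding separated_between_def by blast
  have "topspace T - K = L" "K \<subseteq> topspace T" using KL(3,4) by (auto simp: disjnt_def)
  then have "closedin T K" using KL(2) by (simp add: closedin_def)
  moreover have "K \<subseteq> A" using KL(3,4,6) by (auto simp: disjnt_def)
  moreover have "x \<in> K" using KL(5) C by simp
  ultimately show ?thesis using KL(1) by blast
qed

text \<open>For a clopen set \<open>K\<close> containing \<open>\<one>\<close>, take the elements that can be inserted anywhere into a product without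
  changing whether it lies in \<open>K\<close>. They form a normal subgroup inside \<open>K\<close>. Its
  complement is the projection, along the compact factor \<open>G \<times> G\<close>, of a clopen set of triples, so it
  is closed.\<close>

lemma open_normal_subgroup_below:
  assumes "openin T A" "\<one> \<in> A"
  shows "\<exists>N. N \<lhd> G \<and> openin T N \<and> N \<subseteq> A"
proof -
  obtain K where K: "openin T K" "closedin T K" "\<one> \<in> K" "K \<subseteq> A"
    using clopen_neighbourhood[OF assms] by blast
  define N where "N = {g \<in> carrier G. \<forall>x\<in>carrier G. \<forall>y\<in>carrier G. x \<otimes> g \<otimes> y \<in> K \<longleftrightarrow> x \<otimes> y \<in> K}"
  have NI: "g \<in> N" if "g \<in> carrier G"
    "\<And>x y. x \<in> carrier G \<Longrightarrow> y \<in> carrier G \<Longrightarrow> x \<otimes> g \<otimes> y \<in> K \<longleftrightarrow> x \<otimes> y \<in> K" for g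
    using that by (auto simp: N_def)
  have ND: "x \<otimes> g \<otimes> y \<in> K \<longleftrightarrow> x \<otimes> y \<in> K" if "g \<in> N" "x \<in> carrier G" "y \<in> carrier G" for g x y
    using that by (auto simp: N_def)
  have NG: "g \<in> carrier G" if "g \<in> N" for g using that by (simp add: N_def)
  have sub: "subgroup N G"
  proof (rule subgroupI)
    show "N \<subseteq> carrier G" using NG by blast
    have "\<one> \<in> N" by (rule NI) auto
    then show "N \<noteq> {}" by blast
    fix g assume g: "g \<in> N"
    show "inv g \<in> N"
    proof (rule NI)
      show "inv g \<in> carrier G" using NG[OF g] by simp
      fix x y assume xy: "x \<in> carrier G" "y \<in> carrier G"
      have "x \<otimes> inv g \<otimes> g \<otimes> y = x \<otimes> y" using xy NG[OF g] by (simp add: m_assoc)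
      then show "x \<otimes> inv g \<otimes> y \<in> K \<longleftrightarrow> x \<otimes> y \<in> K"
        using ND[OF g, of "x \<otimes> inv g" y] xy NG[OF g] by simp
    qed
    fix h assume h: "h \<in> N"
    show "g \<otimes> h \<in> N"
    proof (rule NI)
      show "g \<otimes> h \<in> carrier G" using NG[OF g] NG[OF h] by simp
      fix x y assume xy: "x \<in> carrier G" "y \<in> carrier G"
      have "x \<otimes> (g \<otimes> h) \<otimes> y = x \<otimes> g \<otimes> (h \<otimes> y)" "x \<otimes> h \<otimes> y = x \<otimes> (h \<otimes> y)"
        using xy NG[OF g] NG[OF h] by (simp_all add: m_assoc)
      then show "x \<otimes> (g \<otimes> h) \<otimes> y \<in> K \<longleftrightarrow> x \<otimes> y \<in> K"
        using ND[OF g, of x "h \<otimes> y"] ND[OF h, of x y] xy NG[OF h] by simp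
    qed
  qed
  have "N \<lhd> G"
    unfolding normal_inv_iff
  proof (intro conjI sub ballI)
    fix a g assume a: "a \<in> carrier G" and g: "g \<in> N"
    show "a \<otimes> g \<otimes> inv a \<in> N"
    proof (rule NI)
      show "a \<otimes> g \<otimes> inv a \<in> carrier G" using NG[OF g] a by simp
      fix x y assume xy: "x \<in> carrier G" "y \<in> carrier G"
      have "x \<otimes> (a \<otimes> g \<otimes> inv a) \<otimes> y = (x \<otimes> a) \<otimes> g \<otimes> (inv a \<otimes> y)"
        "x \<otimes> y = (x \<otimes> a) \<otimes> (inv a \<otimes> y)"
        using xy NG[OF g] a by (simp_all add: m_assoc) (simp add: m_assoc[symmetric])
      then show "x \<otimes> (a \<otimes> g \<otimes> inv a) \<otimes> y \<in> K \<longleftrightarrow> x \<otimes> y \<in> K"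
        using ND[OF g, of "x \<otimes> a" "inv a \<otimes> y"] xy a by simp
    qed
  qed
  moreover have "N \<subseteq> K"
  proof
    fix g assume g: "g \<in> N"
    then show "g \<in> K" using ND[OF g, of \<one> \<one>] NG[OF g] K(3) by simp
  qed
  moreover have "openin T N"
  proof -
    let ?X = "prod_topology (prod_topology T T) T"
    have c: "continuous_map ?X T (fst \<circ> fst)" "continuous_map ?X T (snd \<circ> fst)"
      "continuous_map ?X T snd"
      by (rule continuous_map_compose[OF continuous_map_fst continuous_map_fst]
          continuous_map_compose[OF continuous_map_fst continuous_map_snd] continuous_map_snd)+
    note c = c[unfolded comp_def]
    define f where "f = (\<lambda>z. fst (fst z) \<otimes> snd z \<otimes> snd (fst z))"
    define g where "g = (\<lambda>z :: ('a \<times> 'a) \<times> 'a. fst (fst z) \<otimes> snd (fst z))"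
    have f: "continuous_map ?X T f" and g: "continuous_map ?X T g"
      unfolding f_def g_def by (intro continuous_map_mult c)+
    have pre: "closedin ?X {z \<in> topspace ?X. h z \<in> L}" if "continuous_map ?X T h" "closedin T L" for h L
      using that by (rule closedin_continuous_map_preimage)
    have K': "closedin T (topspace T - K)" using K(1) by (simp add: closedin_diff)

    \<comment> \<open>the triples \<open>((x, y), a)\<close> for which inserting \<open>a\<close> between \<open>x\<close> and \<open>y\<close> changes membership in \<open>K\<close>\<close>
    define D where "D = ({z \<in> topspace ?X. f z \<in> K} \<inter> {z \<in> topspace ?X. g z \<in> topspace T - K}) \<union>
        ({z \<in> topspace ?X. f z \<in> topspace T - K} \<inter> {z \<in> topspace ?X. g z \<in> K})"
    have "closedin ?X D"
      unfolding D_def by (intro closedin_Un closedin_Int pre f g K(2) K')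
    moreover have "closed_map ?X T snd"
      using compact by (intro closed_map_snd) (simp add: compact_space_prod_topology)
    ultimately have "closedin T (snd ` D)" unfolding closed_map_def by blast
    moreover have "topspace T - snd ` D = N"
    proof (intro equalityI subsetI)
      fix a assume a: "a \<in> topspace T - snd ` D"
      show "a \<in> N"
      proof (rule NI)
        show "a \<in> carrier G" using a by (simp add: topspace_eq)
        fix x y assume xy: "x \<in> carrier G" "y \<in> carrier G"
        have "((x, y), a) \<notin> D" using a by force
        then show "x \<otimes> a \<otimes> y \<in> K \<longleftrightarrow> x \<otimes> y \<in> K"
          using a xy by (auto simp: D_def f_def g_def topspace_eq)
      qed
    next
      fix a assume a: "a \<in> N"
      then have "((x, y), a) \<notin> D" for x y
        using ND[OF a, of x y] by (auto simp: D_def f_def g_def topspace_eq)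
      then show "a \<in> topspace T - snd ` D" using NG[OF a] by (force simp: topspace_eq)
    qed
    ultimately show ?thesis by (metis openin_diff openin_topspace)
  qed
  ultimately show ?thesis using K(4) by blast
qed

text \<open>A copy of \<open>G/N\<close> on a set of natural numbers, obtained by numbering the finitely many cosets.\<close>

lemma open_normal_subgroup_kernel:
  assumes N: "N \<lhd> G" and op: "openin T N"
  shows "\<exists>(A :: nat monoid) \<phi>. group A \<and> finite (carrier A) \<and> group_hom G A \<phi> \<and> kernel G A \<phi> = N"
proof -
  interpret N: normal N G by fact
  have sub: "subgroup N G" by (rule N.subgroup_axioms)
  obtain F where F: "finite F" "F \<subseteq> carrier G" "carrier G \<subseteq> (\<Union>x\<in>F. l_coset G x N)"
    using open_subgroup_finite_cover[OF sub op] by blast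
  have "(\<lambda>x. N #> x) ` carrier G \<subseteq> (\<lambda>x. N #> x) ` F"
  proof clarify
    fix y assume "y \<in> carrier G"
    then obtain x where x: "x \<in> F" "y \<in> N #> x"
      using F N.coset_eq by (metis (no_types, lifting) UN_E subsetD)
    then have "N #> x = N #> y" using F(2) sub by (intro repr_independence) auto
    then show "N #> y \<in> (\<lambda>x. N #> x) ` F" using x(1) by blast
  qed
  then have fin: "finite ((\<lambda>x. N #> x) ` carrier G)" using F(1) by (meson finite_imageI finite_subset)
  define \<phi> where "\<phi> = to_nat_on ((\<lambda>x. N #> x) ` carrier G) \<circ> (\<lambda>x. N #> x)"
  have "\<phi> a = \<phi> b \<longleftrightarrow> a \<otimes> inv b \<in> N" if "a \<in> carrier G" "b \<in> carrier G" for a b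
  proof -
    have "\<phi> a = \<phi> b \<longleftrightarrow> N #> a = N #> b"
      using that fin by (simp add: \<phi>_def to_nat_on_inj countable_finite)
    also have "\<dots> \<longleftrightarrow> a \<otimes> inv b \<in> N"
      using that sub
      by (metis N.rcos_module rcos_self is_group repr_independence)
    finally show ?thesis .
  qed
  then have wk: "weak_group_morphism \<phi> N G" by (intro weak_group_morphismsI N) auto
  have "finite (carrier (image_group \<phi> G))"
    unfolding image_group_carrier \<phi>_def image_comp[symmetric] by (rule finite_imageI[OF fin])
  then show ?thesis
    using image_group_is_group[OF wk] weak_group_morphism_group_hom[OF wk] weak_group_morphism_ker[OF wk]
    by blast
qed

end


section \<open>Transfer from \<open>G\<close> to \<open>H\<close> and the isomorphism\<close>

text \<open>Given a neighbourhood of \<open>\<one>\<close>, choose an open normal subgroup \<open>N\<close> inside it and a word that vanishes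
  on the finite group \<open>G/N\<close>. The condition \<open>P\<close> is left open because the words are chosen with
  \<open>w(G)\<close> open for one group, but are also used to find small verbal subgroups in the other.\<close>

lemma (in profinite_group) verbal_subgroup_in_neighbourhood:
  assumes words: "\<And>A :: nat monoid. group A \<Longrightarrow> finite (carrier A) \<Longrightarrow>
      \<exists>n. \<exists>w \<in> group_words n. verbal_subgroup A n w = {\<one>\<^bsub>A\<^esub>} \<and> P n w"
    and U: "openin T U" "\<one> \<in> U"
  shows "\<exists>n. \<exists>w \<in> group_words n. verbal_subgroup G n w \<subseteq> U \<and> P n w"
proof -
  obtain N where N: "N \<lhd> G" "openin T N" "N \<subseteq> U"
    using open_normal_subgroup_below[OF U] by blast
  obtain A :: "nat monoid" and \<phi> where A: "group A" "finite (carrier A)" "group_hom G A \<phi>"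
    "kernel G A \<phi> = N"
    using open_normal_subgroup_kernel[OF N(1,2)] by blast
  obtain n w where w: "w \<in> group_words n" "verbal_subgroup A n w = {\<one>\<^bsub>A\<^esub>}" "P n w"
    using words[OF A(1,2)] by blast
  have "verbal_subgroup G n w \<subseteq> N"
    using verbal_subgroup_subset_kernel[OF A(3) w(1,2)] A(4) by simp
  with N(3) w show ?thesis by blast
qed

text \<open>With a common width \<open>M\<close>, the same formula defines \<open>w(G)\<close> in \<open>G\<close> and \<open>w(H)\<close> in \<open>H\<close>.\<close>

definition uniform_width ::
    "('a, 'x) monoid_scheme \<Rightarrow> ('b, 'y) monoid_scheme \<Rightarrow> 'b topology \<Rightarrow> nat \<Rightarrow> gword \<Rightarrow> nat \<Rightarrow> bool" where
  "uniform_width G H T n w M \<longleftrightarrow> w \<in> group_words n \<and>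
     verbal_subgroup G n w = verbal_ball G n w M \<and>
     verbal_subgroup H n w = verbal_ball H n w M \<and> openin T (verbal_subgroup H n w)"

text \<open>Let \<open>M\<close> be a width for the open subgroup \<open>w(G)\<close>. That the balls of radius \<open>M\<close> and \<open>M + 1\<close> coincide is
  first-order, so \<open>w(H)\<close> is a ball as well, and therefore compact. That finitely many translates of the
  ball cover the group is first-order too, so \<open>w(H)\<close> has finite index and is open.\<close>

lemma verbal_subgroup_transfer:
  fixes G :: "('a, 'x) monoid_scheme" and H :: "('b, 'y) monoid_scheme"
  assumes G: "profinite_group G S" and H: "profinite_group H T"
    and eq: "elementarily_equivalent G H"
    and w: "w \<in> group_words n" and op: "openin S (verbal_subgroup G n w)"
  shows "\<exists>M k g. uniform_width G H T n w M \<and> range g \<subseteq> carrier G \<and> sat G g (cover_formula n w M k)"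
proof -
  interpret G: profinite_group G S by fact
  interpret H: profinite_group H T by fact
  obtain M where M: "verbal_subgroup G n w = verbal_ball G n w M"
    using G.open_verbal_subgroup_eq_ball[OF w op] by blast
  have subG: "subgroup (verbal_subgroup G n w) G" by (rule G.verbal_subgroup_is_subgroup[OF w])
  have subH: "subgroup (verbal_subgroup H n w) H" by (rule H.verbal_subgroup_is_subgroup[OF w])

  let ?p = "Disj (Neg (ball_formula n w (Suc M))) (ball_formula n w M)"
  have "verbal_ball G n w (Suc M) \<subseteq> verbal_ball G n w M"
    using G.verbal_subgroup_UN[OF w] M by blast
  then have "sat G e ?p" if e: "range e \<subseteq> carrier G" for e :: "nat \<Rightarrow> 'a"
    unfolding sat_Disj sat.simps G.sat_ball_formula[OF w e] by blast
  then have "models G ?p" by (simp only: models_def) blast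
  then have "models H ?p" using elementarily_equivalent_models[OF eq] by blast
  have stable: "inv\<^bsub>H\<^esub> e 0 \<otimes>\<^bsub>H\<^esub> e 1 \<in> verbal_ball H n w (Suc M) \<longrightarrow>
      inv\<^bsub>H\<^esub> e 0 \<otimes>\<^bsub>H\<^esub> e 1 \<in> verbal_ball H n w M" if e: "range e \<subseteq> carrier H" for e :: "nat \<Rightarrow> 'b"
  proof -
    have "sat H e ?p" using \<open>models H ?p\<close> e unfolding models_def by blast
    then show ?thesis unfolding sat_Disj sat.simps H.sat_ball_formula[OF w e] by blast
  qed
  have "verbal_ball H n w (Suc M) \<subseteq> verbal_ball H n w M"
  proof
    fix y assume y: "y \<in> verbal_ball H n w (Suc M)"
    then have "y \<in> carrier H" using H.verbal_ball_subset[OF w] by blast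
    then have "range ((\<lambda>_. \<one>\<^bsub>H\<^esub>)(1 := y)) \<subseteq> carrier H" by auto
    from stable[OF this] show "y \<in> verbal_ball H n w M"
      using y \<open>y \<in> carrier H\<close> by (simp del: verbal_ball.simps)
  qed
  then have MH: "verbal_subgroup H n w = verbal_ball H n w M"
    by (rule H.verbal_subgroup_eq_ball[OF w])

  obtain F where F: "finite F" "F \<subseteq> carrier G"
    "carrier G \<subseteq> (\<Union>x\<in>F. l_coset G x (verbal_subgroup G n w))"
    using G.open_subgroup_finite_cover[OF subG op] by blast
  obtain xs where xs: "set xs = F" using finite_list[OF F(1)] ..
  define k where "k = length xs"
  define g where "g i = (if i < k then xs ! i else \<one>\<^bsub>G\<^esub>)" for i
  have g: "range g \<subseteq> carrier G" using F(2) xs by (auto simp: g_def k_def)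
  have cover: "sat G g (cover_formula n w M k)"
    unfolding G.sat_cover_formula[OF w g]
  proof
    fix y assume y: "y \<in> carrier G"
    then obtain x where x: "x \<in> F" "y \<in> l_coset G x (verbal_subgroup G n w)" using F(3) by blast
    then obtain i where i: "i < k" "x = g i" by (auto simp: g_def k_def xs[symmetric] in_set_conv_nth)
    have "inv\<^bsub>G\<^esub> x \<otimes>\<^bsub>G\<^esub> y \<in> verbal_ball G n w M"
      using x y F(2) G.mem_coset_iff[OF subG] M by blast
    then show "\<exists>i<k. inv\<^bsub>G\<^esub> g i \<otimes>\<^bsub>G\<^esub> y \<in> verbal_ball G n w M" using i by blast
  qed
  then obtain h where h: "range h \<subseteq> carrier H" "sat H h (cover_formula n w M k)"
    using elementarily_equivalent_satisfiable[OF eq g] by blast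
  have "carrier H \<subseteq> (\<Union>x\<in>h ` {..<k}. l_coset H x (verbal_subgroup H n w))"
  proof
    fix y assume y: "y \<in> carrier H"
    then obtain i where i: "i < k" "inv\<^bsub>H\<^esub> h i \<otimes>\<^bsub>H\<^esub> y \<in> verbal_subgroup H n w"
      using h(2) unfolding H.sat_cover_formula[OF w h(1)] MH by blast
    moreover have "h i \<in> carrier H" using h(1) by blast
    ultimately show "y \<in> (\<Union>x\<in>h ` {..<k}. l_coset H x (verbal_subgroup H n w))"
      using H.mem_coset_iff[OF subH _ y] by blast
  qed
  then have "openin T (verbal_subgroup H n w)"
    using h(1) by (intro H.closed_subgroup_open[OF subH _ finite_imageI[OF finite_lessThan]])
      (auto simp: MH H.closedin_verbal_ball[OF w])
  then have "uniform_width G H T n w M" using w M MH by (simp add: uniform_width_def)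
  with g cover show ?thesis by blast
qed

text \<open>Three families of conditions are realized simultaneously: multiplicativity of \<open>f\<close>, that elements
  outside \<open>w(G)\<close> are sent outside \<open>w(H)\<close>, and that coset representatives of \<open>w(G)\<close> are sent to elements
  whose cosets of \<open>w(H)\<close> cover \<open>H\<close>. They are closed because multiplication is continuous and \<open>w(H)\<close> is
  clopen. That \<open>w(G)\<close> is sent into \<open>w(H)\<close> then follows, as it does for every homomorphism.\<close>

lemma compatible_hom_exists:
  fixes G :: "('a, 'x) monoid_scheme" and H :: "('b, 'y) monoid_scheme"
  assumes G: "profinite_group G S" and H: "profinite_group H T"
    and eq: "elementarily_equivalent G H"
  shows "\<exists>f \<in> hom G H. \<forall>n w. w \<in> group_words n \<longrightarrow> openin S (verbal_subgroup G n w) \<longrightarrow>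
           (\<forall>x\<in>carrier G. f x \<in> verbal_subgroup H n w \<longleftrightarrow> x \<in> verbal_subgroup G n w) \<and>
           (\<forall>y\<in>carrier H. \<exists>x\<in>carrier G. inv\<^bsub>H\<^esub> f x \<otimes>\<^bsub>H\<^esub> y \<in> verbal_subgroup H n w)"
proof -
  interpret G: profinite_group G S by fact
  interpret H: profinite_group H T by fact
  let ?X = "product_topology (\<lambda>_. T) (carrier G)"
  define mult_conds :: "(gformula \<times> (nat \<Rightarrow> 'a)) set" where
    "mult_conds = {(Eq (Mult (Var 0) (Var 1)) (Var 2), (\<lambda>_. x \<otimes>\<^bsub>G\<^esub> y)(0 := x, 1 := y)) | x y.
      x \<in> carrier G \<and> y \<in> carrier G}"
  \<comment> \<open>The ball formula describes \<open>inv x \<otimes> y\<close>; putting \<open>\<one>\<close> for the variable \<open>0\<close> makes it speak about \<open>y\<close>.\<close>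
  define outside_conds :: "(gformula \<times> (nat \<Rightarrow> 'a)) set" where
    "outside_conds = {(Neg (ball_formula n w M), (\<lambda>_. x)(0 := \<one>\<^bsub>G\<^esub>)) | n w M x.
      uniform_width G H T n w M \<and> x \<in> carrier G \<and> x \<notin> verbal_subgroup G n w}"
  define cover_conds :: "(gformula \<times> (nat \<Rightarrow> 'a)) set" where
    "cover_conds = {(cover_formula n w M k, g) | n w M k g.
      uniform_width G H T n w M \<and> range g \<subseteq> carrier G \<and> sat G g (cover_formula n w M k)}"
  have topX: "topspace ?X = carrier G \<rightarrow>\<^sub>E carrier H" by (simp add: H.topspace_eq)
  have proj: "continuous_map ?X T (\<lambda>f. f x)" if "x \<in> carrier G" for x
    using that by (rule continuous_map_product_projection)
  have range_comp: "range (f \<circ> s) \<subseteq> carrier H"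
    if "f \<in> carrier G \<rightarrow>\<^sub>E carrier H" "range s \<subseteq> carrier G" for f and s :: "nat \<Rightarrow> 'a"
    using that by (auto simp: PiE_iff image_subset_iff)
  have "\<exists>f \<in> carrier G \<rightarrow>\<^sub>E carrier H. \<forall>(p, s)\<in>mult_conds \<union> outside_conds \<union> cover_conds. sat H (f \<circ> s) p"
  proof (rule compact_realization[OF eq _ H.compact H.topspace_eq])
    show "carrier G \<noteq> {}" using G.one_closed by blast
    fix p s assume "(p, s) \<in> mult_conds \<union> outside_conds \<union> cover_conds"
    then consider (1) "(p, s) \<in> mult_conds" | (2) "(p, s) \<in> outside_conds" | (3) "(p, s) \<in> cover_conds" by blast
    then have "(range s \<subseteq> carrier G \<and> sat G s p) \<and>
        closedin ?X {f \<in> carrier G \<rightarrow>\<^sub>E carrier H. sat H (f \<circ> s) p}"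
    proof cases
      case 1
      then obtain x y where p: "p = Eq (Mult (Var 0) (Var 1)) (Var 2)"
        and s: "s = (\<lambda>_. x \<otimes>\<^bsub>G\<^esub> y)(0 := x, 1 := y)" and xy: "x \<in> carrier G" "y \<in> carrier G"
        unfolding mult_conds_def by blast
      have "closedin ?X {f \<in> topspace ?X. f x \<otimes>\<^bsub>H\<^esub> f y = f (x \<otimes>\<^bsub>G\<^esub> y)}"
        by (intro closedin_continuous_maps_eq[OF H.Hausdorff] H.continuous_map_mult proj G.m_closed xy)
      then show ?thesis using xy by (auto simp: p s topX H.topspace_eq)
    next
      case 2
      then obtain n w M x where p: "p = Neg (ball_formula n w M)" and s: "s = (\<lambda>_. x)(0 := \<one>\<^bsub>G\<^esub>)"
        and M: "uniform_width G H T n w M" and x: "x \<in> carrier G" "x \<notin> verbal_subgroup G n w"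
        unfolding outside_conds_def by blast
      have w: "w \<in> group_words n" and MG: "verbal_subgroup G n w = verbal_ball G n w M"
        and MH: "verbal_subgroup H n w = verbal_ball H n w M" and op: "openin T (verbal_subgroup H n w)"
        using M by (auto simp: uniform_width_def)
      have s': "range s \<subseteq> carrier G" using x s by auto
      have "sat G s p" using x unfolding p sat.simps G.sat_ball_formula[OF w s'] MG by (simp add: s)
      moreover have "{f \<in> carrier G \<rightarrow>\<^sub>E carrier H. sat H (f \<circ> s) p} =
          {f \<in> topspace ?X. inv\<^bsub>H\<^esub> f \<one>\<^bsub>G\<^esub> \<otimes>\<^bsub>H\<^esub> f x \<in> topspace T - verbal_subgroup H n w}"
        unfolding p sat.simps topX MH
        using H.sat_ball_formula[OF w range_comp[OF _ s']] x(1)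
        by (auto simp: s H.topspace_eq PiE_iff)
      moreover have "closedin ?X \<dots>"
        by (intro closedin_continuous_map_preimage[where Y = T] H.continuous_map_mult
            H.continuous_map_inv proj x(1) G.one_closed closedin_diff closedin_topspace op)
      ultimately show ?thesis using s' by simp
    next
      case 3
      then obtain n w M k where p: "p = cover_formula n w M k"
        and M: "uniform_width G H T n w M" and s: "range s \<subseteq> carrier G" "sat G s p"
        unfolding cover_conds_def by blast
      have w: "w \<in> group_words n" and MH: "verbal_subgroup H n w = verbal_ball H n w M"
        using M by (auto simp: uniform_width_def)
      have "{f \<in> carrier G \<rightarrow>\<^sub>E carrier H. sat H (f \<circ> s) p} =
          (\<Inter>y\<in>carrier H. \<Union>i\<in>{..<k}. {f \<in> topspace ?X. inv\<^bsub>H\<^esub> f (s i) \<otimes>\<^bsub>H\<^esub> y \<in> verbal_ball H n w M})"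
        (is "?L = ?R")
      proof -
        have L: "f \<in> ?L \<longleftrightarrow> f \<in> carrier G \<rightarrow>\<^sub>E carrier H \<and>
            (\<forall>y\<in>carrier H. \<exists>i<k. inv\<^bsub>H\<^esub> f (s i) \<otimes>\<^bsub>H\<^esub> y \<in> verbal_ball H n w M)" for f
          unfolding p using H.sat_cover_formula[OF w range_comp[OF _ s(1)]] by auto
        have R: "f \<in> ?R \<longleftrightarrow> f \<in> carrier G \<rightarrow>\<^sub>E carrier H \<and>
            (\<forall>y\<in>carrier H. \<exists>i<k. inv\<^bsub>H\<^esub> f (s i) \<otimes>\<^bsub>H\<^esub> y \<in> verbal_ball H n w M)" for f
          unfolding topX using H.one_closed by auto
        show ?thesis
        proof (rule Set.set_eqI)
          fix f show "f \<in> ?L \<longleftrightarrow> f \<in> ?R" by (rule trans[OF L R[symmetric]])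
        qed
      qed
      moreover have "closedin ?X ?R"
      proof (intro closedin_INT closedin_Union)
        show "carrier H \<noteq> {}" using H.one_closed by blast
        fix y D assume y: "y \<in> carrier H"
          and "D \<in> (\<lambda>i. {f \<in> topspace ?X. inv\<^bsub>H\<^esub> f (s i) \<otimes>\<^bsub>H\<^esub> y \<in> verbal_ball H n w M}) ` {..<k}"
        then obtain i where D: "D = {f \<in> topspace ?X. inv\<^bsub>H\<^esub> f (s i) \<otimes>\<^bsub>H\<^esub> y \<in> verbal_ball H n w M}"
          by blast
        have "s i \<in> carrier G" using s(1) by blast
        then show "closedin ?X D"
          unfolding D using y
          by (intro closedin_continuous_map_preimage[where Y = T] H.continuous_map_mult
              H.continuous_map_inv proj H.closedin_verbal_ball[OF w])
            (simp_all add: H.topspace_eq)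
      qed simp
      ultimately show ?thesis using s by simp
    qed
    then show "range s \<subseteq> carrier G \<and> sat G s p"
      and "closedin ?X {f \<in> carrier G \<rightarrow>\<^sub>E carrier H. sat H (f \<circ> s) p}" by blast+
  qed
  then obtain f where f: "f \<in> carrier G \<rightarrow>\<^sub>E carrier H"
    and sat: "\<And>p s. (p, s) \<in> mult_conds \<union> outside_conds \<union> cover_conds \<Longrightarrow> sat H (f \<circ> s) p" by blast
  have fH: "f x \<in> carrier H" if "x \<in> carrier G" for x using f that by auto
  have "f x \<otimes>\<^bsub>H\<^esub> f y = f (x \<otimes>\<^bsub>G\<^esub> y)" if "x \<in> carrier G" "y \<in> carrier G" for x y
    using sat[of "Eq (Mult (Var 0) (Var 1)) (Var 2)" "(\<lambda>_. x \<otimes>\<^bsub>G\<^esub> y)(0 := x, 1 := y)"] that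
    by (auto simp: mult_conds_def)
  then have hom: "f \<in> hom G H" using fH by (auto simp: hom_def)
  then interpret f: group_hom G H f
    by unfold_locales
  have "(\<forall>x\<in>carrier G. f x \<in> verbal_subgroup H n w \<longleftrightarrow> x \<in> verbal_subgroup G n w) \<and>
        (\<forall>y\<in>carrier H. \<exists>x\<in>carrier G. inv\<^bsub>H\<^esub> f x \<otimes>\<^bsub>H\<^esub> y \<in> verbal_subgroup H n w)"
    if w: "w \<in> group_words n" and op: "openin S (verbal_subgroup G n w)" for n w
  proof (intro conjI ballI iffI)
    obtain M k g where M: "uniform_width G H T n w M" and g: "range g \<subseteq> carrier G"
      and cover: "sat G g (cover_formula n w M k)"
      using verbal_subgroup_transfer[OF G H eq w op] by blast
    have MH: "verbal_subgroup H n w = verbal_ball H n w M" using M by (simp add: uniform_width_def)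
    {
      fix x assume x: "x \<in> carrier G" "f x \<in> verbal_subgroup H n w"
      show "x \<in> verbal_subgroup G n w"
      proof (rule ccontr)
        assume "x \<notin> verbal_subgroup G n w"
        then have "(Neg (ball_formula n w M), (\<lambda>_. x)(0 := \<one>\<^bsub>G\<^esub>)) \<in> outside_conds"
          using M x(1) unfolding outside_conds_def by blast
        then have neg: "\<not> sat H (f \<circ> (\<lambda>_. x)(0 := \<one>\<^bsub>G\<^esub>)) (ball_formula n w M)"
          using sat[of "Neg (ball_formula n w M)"] by auto
        have "range (f \<circ> (\<lambda>_. x)(0 := \<one>\<^bsub>G\<^esub>)) \<subseteq> carrier H"
          using x(1) fH by auto
        from H.sat_ball_formula[OF w this] neg x MH fH[OF x(1)] show False by simp
      qed
    next
      fix x assume x: "x \<in> carrier G" "x \<in> verbal_subgroup G n w"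
      show "f x \<in> verbal_subgroup H n w"
        by (rule G.hom_verbal_subgroup[OF f.group_hom_axioms w x(2)])
    next
      fix y assume y: "y \<in> carrier H"
      have "(cover_formula n w M k, g) \<in> cover_conds" unfolding cover_conds_def using M g cover by blast
      then have "sat H (f \<circ> g) (cover_formula n w M k)" using sat by blast
      then obtain i where "inv\<^bsub>H\<^esub> f (g i) \<otimes>\<^bsub>H\<^esub> y \<in> verbal_subgroup H n w"
        unfolding H.sat_cover_formula[OF w range_comp[OF f g]] MH using y by auto
      moreover have "g i \<in> carrier G" using g by blast
      ultimately show "\<exists>x\<in>carrier G. inv\<^bsub>H\<^esub> f x \<otimes>\<^bsub>H\<^esub> y \<in> verbal_subgroup H n w" by blast
    }
  qed
  with hom show ?thesis by blast
qed

theorem proposition1p4: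
  fixes G :: "('a, 'x) monoid_scheme" and S :: "'a topology"
    and H :: "('b, 'y) monoid_scheme" and T :: "'b topology"
  assumes "profinite_group G S"
    and "profinite_group H T"
    and "elementarily_equivalent G H"
    and "small_group G S"
    and "\<And>A :: nat monoid. group A \<Longrightarrow> finite (carrier A) \<Longrightarrow>
           \<exists>n. \<exists>w \<in> group_words n.
             verbal_subgroup A n w = {\<one>\<^bsub>A\<^esub>} \<and> openin S (verbal_subgroup G n w)"
  shows "profinite_iso G S H T"
proof -
  interpret G: profinite_group G S by fact
  interpret H: profinite_group H T by fact
  obtain f where hom: "f \<in> hom G H"
    and mem: "\<And>n w x. w \<in> group_words n \<Longrightarrow> openin S (verbal_subgroup G n w) \<Longrightarrow> x \<in> carrier G \<Longrightarrow>
      f x \<in> verbal_subgroup H n w \<longleftrightarrow> x \<in> verbal_subgroup G n w"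
    and dense: "\<And>n w y. w \<in> group_words n \<Longrightarrow> openin S (verbal_subgroup G n w) \<Longrightarrow> y \<in> carrier H \<Longrightarrow>
      \<exists>x\<in>carrier G. inv\<^bsub>H\<^esub> f x \<otimes>\<^bsub>H\<^esub> y \<in> verbal_subgroup H n w"
    using compatible_hom_exists[OF assms(1-3)] by blast
  interpret f: group_hom G H f
    using hom by unfold_locales
  have baseG: "\<exists>n. \<exists>w\<in>group_words n. verbal_subgroup G n w \<subseteq> U \<and> openin S (verbal_subgroup G n w)"
    if "openin S U" "\<one>\<^bsub>G\<^esub> \<in> U" for U
    using G.verbal_subgroup_in_neighbourhood[of "\<lambda>n w. openin S (verbal_subgroup G n w)", OF assms(5) that] .
  have baseH: "\<exists>n. \<exists>w\<in>group_words n. verbal_subgroup H n w \<subseteq> U \<and> openin S (verbal_subgroup G n w)"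
    if "openin T U" "\<one>\<^bsub>H\<^esub> \<in> U" for U
    using H.verbal_subgroup_in_neighbourhood[of "\<lambda>n w. openin S (verbal_subgroup G n w)", OF assms(5) that] .
  have translated: "\<exists>n. \<exists>w\<in>group_words n. openin S (verbal_subgroup G n w) \<and>
      (\<forall>z\<in>verbal_subgroup H n w. y \<otimes>\<^bsub>H\<^esub> z \<in> U)"
    if U: "openin T U" "y \<in> U" for U y
  proof -
    have y: "y \<in> carrier H" using openin_subset[OF U(1)] U(2) by (auto simp: H.topspace_eq)
    have "openin T {z \<in> topspace T. y \<otimes>\<^bsub>H\<^esub> z \<in> U}"
      by (rule openin_continuous_map_preimage[OF H.continuous_map_translate[OF y] U(1)])
    moreover have "\<one>\<^bsub>H\<^esub> \<in> {z \<in> topspace T. y \<otimes>\<^bsub>H\<^esub> z \<in> U}" using U y by (simp add: H.topspace_eq)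
    ultimately obtain n w where w: "w \<in> group_words n" "openin S (verbal_subgroup G n w)"
      "verbal_subgroup H n w \<subseteq> {z \<in> topspace T. y \<otimes>\<^bsub>H\<^esub> z \<in> U}"
      using baseH by meson
    from w(3) have "\<forall>z\<in>verbal_subgroup H n w. y \<otimes>\<^bsub>H\<^esub> z \<in> U" by blast
    with w(1,2) show ?thesis by blast
  qed
  have cont: "continuous_map S T f"
    unfolding continuous_map
  proof (intro conjI allI impI)
    show "f ` topspace S \<subseteq> topspace T" by (auto simp: G.topspace_eq H.topspace_eq)
    fix U assume U: "openin T U"
    show "openin S {x \<in> topspace S. f x \<in> U}"
    proof (subst openin_subopen, intro ballI)
      fix x assume "x \<in> {x \<in> topspace S. f x \<in> U}"
      then have x: "x \<in> carrier G" "f x \<in> U" by (auto simp: G.topspace_eq)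
      obtain n w where w: "w \<in> group_words n" "openin S (verbal_subgroup G n w)"
        "\<forall>z\<in>verbal_subgroup H n w. f x \<otimes>\<^bsub>H\<^esub> z \<in> U"
        using translated[OF U x(2)] by blast
      let ?W = "verbal_subgroup G n w"
      have sub: "subgroup ?W G" by (rule G.verbal_subgroup_is_subgroup[OF w(1)])
      have "x \<in> l_coset G x ?W"
        using G.mem_coset_iff[OF sub x(1) x(1)] subgroup.one_closed[OF sub] x(1) by simp
      moreover have "l_coset G x ?W \<subseteq> {x \<in> topspace S. f x \<in> U}"
      proof
        fix y assume "y \<in> l_coset G x ?W"
        then obtain z where z: "z \<in> ?W" "y = x \<otimes>\<^bsub>G\<^esub> z" by (auto simp: l_coset_def)
        then have zG: "z \<in> carrier G" using subgroup.mem_carrier[OF sub] by blast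
        then have "f z \<in> verbal_subgroup H n w" using mem[OF w(1,2)] z(1) by blast
        then show "y \<in> {x \<in> topspace S. f x \<in> U}"
          using w(3) z(2) zG x(1) by (simp add: G.topspace_eq)
      qed
      ultimately show "\<exists>V. openin S V \<and> x \<in> V \<and> V \<subseteq> {x \<in> topspace S. f x \<in> U}"
        using G.openin_translate[OF x(1) w(2)] by blast
    qed
  qed
  have closed: "closed_map S T f"
    by (rule continuous_imp_closed_map_gen[OF G.compact Hausdorff_imp_kc_space[OF H.Hausdorff] cont])
  have inj: "inj_on f (carrier G)"
  proof (rule f.inj_on_one_iff[THEN iffD2], intro allI impI, rule ccontr)
    fix x assume x: "x \<in> carrier G" "f x = \<one>\<^bsub>H\<^esub>" "x \<noteq> \<one>\<^bsub>G\<^esub>"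
    have "closedin S {x}" using G.Hausdorff x(1) by (simp add: closedin_Hausdorff_singleton G.topspace_eq)
    then have "openin S (topspace S - {x})" by (simp add: openin_diff)
    moreover have "\<one>\<^bsub>G\<^esub> \<in> topspace S - {x}" using x by (simp add: G.topspace_eq)
    ultimately obtain n w where w: "w \<in> group_words n" "verbal_subgroup G n w \<subseteq> topspace S - {x}"
      "openin S (verbal_subgroup G n w)"
      using baseG by blast
    have "f x \<in> verbal_subgroup H n w"
      using x(2) subgroup.one_closed[OF H.verbal_subgroup_is_subgroup[OF w(1)]] by simp
    then show False using mem[OF w(1,3) x(1)] w(2) by blast
  qed
  have surj: "f ` carrier G = carrier H"
  proof (intro equalityI subsetI)
    fix y assume y: "y \<in> carrier H"
    show "y \<in> f ` carrier G"
    proof (rule ccontr)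
      assume ny: "y \<notin> f ` carrier G"
      have "closedin T (f ` carrier G)"
        using closed closedin_topspace[of S] unfolding closed_map_def G.topspace_eq by blast
      then have "openin T (topspace T - f ` carrier G)" by (simp add: openin_diff)
      moreover have "y \<in> topspace T - f ` carrier G" using y ny by (simp add: H.topspace_eq)
      ultimately obtain n w where w: "w \<in> group_words n" "openin S (verbal_subgroup G n w)"
        "\<forall>z\<in>verbal_subgroup H n w. y \<otimes>\<^bsub>H\<^esub> z \<in> topspace T - f ` carrier G"
        using translated by meson
      obtain x where x: "x \<in> carrier G" "inv\<^bsub>H\<^esub> f x \<otimes>\<^bsub>H\<^esub> y \<in> verbal_subgroup H n w"
        using dense[OF w(1,2) y] by blast
      then have "inv\<^bsub>H\<^esub> (inv\<^bsub>H\<^esub> f x \<otimes>\<^bsub>H\<^esub> y) \<in> verbal_subgroup H n w"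
        using H.verbal_subgroup_is_subgroup[OF w(1)] by (simp add: subgroup.m_inv_closed)
      then have "inv\<^bsub>H\<^esub> y \<otimes>\<^bsub>H\<^esub> f x \<in> verbal_subgroup H n w"
        using x(1) y by (simp add: H.inv_mult_group)
      then have "y \<otimes>\<^bsub>H\<^esub> (inv\<^bsub>H\<^esub> y \<otimes>\<^bsub>H\<^esub> f x) \<notin> f ` carrier G" using w(3) by blast
      then show False using x(1) y by (simp add: H.m_assoc[symmetric])
    qed
  qed auto
  have "f \<in> iso G H" using hom inj surj by (simp add: iso_def bij_betw_def)
  moreover have "homeomorphic_map S T f"
    using bijective_closed_imp_homeomorphic_map[OF cont closed] inj surj
    by (simp add: G.topspace_eq H.topspace_eq)
  ultimately show ?thesis unfolding profinite_iso_def by blast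
qed

end
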